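(* Let $n$ be a positive integer, let $a$ and $b$ be nonzero constants, and let $f$ be a smooth function of $u$ such that $f_{uu}\neq 0$ (that is, $f_{uu}$ is not identically zero). Then the partial differential equation $$u_{tx}+(f(u))_{tt}+a\,u_{ttt}+b\,\Delta_y u=0, \qquad (\mathrm{E})$$ for one dependent variable $u$ in the $n+2$ independent variables $x,t,y_1,\dots,y_n$, where $\Delta_y=\sum_{i=1}^n \partial^2/\partial y_i^2$, has infinitely many (pairwise inequivalent) nontrivial local conservation laws.
   Context: Subscripts denote partial derivatives (total derivatives when applied to expressions depending on $u$ and its derivatives). A differential function is a smooth function depending on $x,t,y_1,\dots,y_n$, $u$ and finitely many derivatives of $u$. Let $D_t,D_x,D_{y_j}$ denote the total derivatives. A local conservation law of (E) is a tuple $(\rho,\sigma,\zeta_1,\dots,\zeta_n)$ of differential functions such that $D_t\rho+D_x\sigma+\sum_{j=1}^n D_{y_j}\zeta_j=0$ holds modulo (E) and its differential consequences (i.e. on all solutions of (E)). A local conservation law is trivial if its tuple is a sum of two tuples of differential functions: one whose components all vanish modulo (E) and its differential consequences, and one whose total divergence $D_t\rho+D_x\sigma+\sum_j D_{y_j}\zeta_j$ vanishes identically (for all functions $u$, without using (E)). It is nontrivial otherwise. Two local conservation laws are equivalent if they differ by a trivial one. *)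

theory Defs
  imports "HOL-Analysis.Analysis" "HOL-Library.Multiset" "HOL-Library.Groups_Big_Fun"
begin

text \<open>
  Independent variables \<open>x\<close>, \<open>t\<close>, \<open>y\<^sub>j\<close>.  The \<open>y\<^sub>j\<close> are indexed by a type of class \<open>finite\<close>, so the
  number \<open>n\<close> of them is \<open>CARD('n) \<ge> 1\<close>.
\<close>

datatype 'n indvar = Vx | Vt | Vy 'n

text \<open>
  Coordinates on the infinite jet space: the independent variables and the derivatives \<open>u\<^sub>J\<close> of the
  dependent variable.  Since mixed derivatives commute, \<open>J\<close> is a multiset of independent variables,
  e.g. \<open>U {#}\<close> is \<open>u\<close> and \<open>U {#Vt, Vx#}\<close> is \<open>u\<^sub>t\<^sub>x\<close>.
\<close>

datatype 'n coord = Ind "'n indvar" | U "'n indvar multiset"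

type_synonym 'n jet = "'n coord \<Rightarrow> real"

type_synonym 'n jet_fun = "'n jet \<Rightarrow> real"

definition partial_deriv :: "'n coord \<Rightarrow> 'n jet_fun \<Rightarrow> 'n jet_fun" where
  "partial_deriv c F p = deriv (\<lambda>s. F (p(c := s))) (p c)"

text \<open>
  Smooth functions of finitely many of the coordinates.  Smoothness is stated as: all iterated
  partial derivatives exist and are continuous.  Continuity refers to the product topology on
  jets; for a function of finitely many coordinates this is ordinary continuity in these.
\<close>

definition differential_function :: "'n jet_fun \<Rightarrow> bool" where
  "differential_function F \<longleftrightarrow>
     (\<exists>S. finite S \<and> (\<forall>p q. (\<forall>c\<in>S. p c = q c) \<longrightarrow> F p = F q)) \<and>
     (\<forall>cs. continuous_on UNIV (fold partial_deriv cs F) \<and>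
           (\<forall>p c. (\<lambda>s. fold partial_deriv cs F (p(c := s))) field_differentiable at (p c)))"

text \<open>
  \<open>D\<^sub>i F = \<partial>F/\<partial>x\<^sub>i + \<Sum>\<^sub>J u\<^sub>J\<^sub>i \<partial>F/\<partial>u\<^sub>J\<close>; only finitely many summands are nonzero if \<open>F\<close> is a differential
  function.
\<close>

definition total_deriv :: "'n indvar \<Rightarrow> 'n jet_fun \<Rightarrow> 'n jet_fun" where
  "total_deriv i F p =
     partial_deriv (Ind i) F p + Sum_any (\<lambda>J. p (U (add_mset i J)) * partial_deriv (U J) F p)"

text \<open>
  The equation \<open>E = 0\<close> together with all its differential consequences, as a subset of the jet
  space (the jets of formal solutions), and vanishing of a function modulo these.
\<close>

definition equation_jets :: "'n jet_fun \<Rightarrow> 'n jet set" where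
  "equation_jets E = {p. \<forall>is. fold total_deriv is E p = 0}"

definition vanishes_modulo :: "'n jet_fun \<Rightarrow> 'n jet_fun \<Rightarrow> bool" where
  "vanishes_modulo E F \<longleftrightarrow> (\<forall>p \<in> equation_jets E. F p = 0)"

text \<open>
  A tuple \<open>(\<rho>, \<sigma>, \<zeta>\<^sub>1, \<dots>, \<zeta>\<^sub>n)\<close> is a family \<open>C\<close> indexed by the independent variables:
  \<open>\<rho> = C Vt\<close>, \<open>\<sigma> = C Vx\<close>, \<open>\<zeta>\<^sub>j = C (Vy j)\<close>.
\<close>

type_synonym 'n jet_tuple = "'n indvar \<Rightarrow> 'n jet_fun"

definition total_divergence :: "('n::finite) jet_tuple \<Rightarrow> 'n jet_fun" where
  "total_divergence C p =
     total_deriv Vt (C Vt) p + total_deriv Vx (C Vx) p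
     + (\<Sum>j\<in>UNIV. total_deriv (Vy j) (C (Vy j)) p)"

definition conservation_law :: "('n::finite) jet_fun \<Rightarrow> 'n jet_tuple \<Rightarrow> bool" where
  "conservation_law E C \<longleftrightarrow>
     (\<forall>i. differential_function (C i)) \<and> vanishes_modulo E (total_divergence C)"

definition trivial_tuple :: "('n::finite) jet_fun \<Rightarrow> 'n jet_tuple \<Rightarrow> bool" where
  "trivial_tuple E C \<longleftrightarrow>
     (\<exists>P Q. (\<forall>i. differential_function (P i)) \<and> (\<forall>i. differential_function (Q i)) \<and>
            (\<forall>i p. C i p = P i p + Q i p) \<and>
            (\<forall>i. vanishes_modulo E (P i)) \<and>
            (\<forall>p. total_divergence Q p = 0))"

definition nontrivial_conservation_law :: "('n::finite) jet_fun \<Rightarrow> 'n jet_tuple \<Rightarrow> bool" where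
  "nontrivial_conservation_law E C \<longleftrightarrow> conservation_law E C \<and> \<not> trivial_tuple E C"

definition equivalent_tuples :: "('n::finite) jet_fun \<Rightarrow> 'n jet_tuple \<Rightarrow> 'n jet_tuple \<Rightarrow> bool" where
  "equivalent_tuples E C C' \<longleftrightarrow> trivial_tuple E (\<lambda>i p. C i p - C' i p)"

definition smooth_real :: "(real \<Rightarrow> real) \<Rightarrow> bool" where
  "smooth_real f \<longleftrightarrow> (\<forall>k x. (deriv ^^ k) f field_differentiable at x)"

text \<open>The left-hand side of \<open>u\<^sub>t\<^sub>x + (f(u))\<^sub>t\<^sub>t + a u\<^sub>t\<^sub>t\<^sub>t + b \<Delta>\<^sub>y u = 0\<close>.\<close>

definition pde_lhs :: "(real \<Rightarrow> real) \<Rightarrow> real \<Rightarrow> real \<Rightarrow> ('n::finite) jet_fun" where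
  "pde_lhs f a b p =
     p (U {#Vt, Vx#}) + total_deriv Vt (total_deriv Vt (\<lambda>q. f (q (U {#})))) p
     + a * p (U {#Vt, Vt, Vt#}) + b * (\<Sum>j\<in>UNIV. p (U {#Vy j, Vy j#}))"

end

theory Submission
  imports Defs
begin

text \<open>
  Multiplying the equation \<open>E = 0\<close> by \<open>h(x)\<close> turns its left-hand side into a divergence, because \<open>h\<close>
  depends neither on \<open>t\<close> nor on the \<open>y\<^sub>j\<close>:
  \<open>h E = D\<^sub>t (h (u\<^sub>x + (f(u))\<^sub>t + a u\<^sub>t\<^sub>t)) + \<Sum>\<^sub>j D\<^sub>y\<^sub>j (b h u\<^sub>y\<^sub>j)\<close>.
  The powers \<open>h(x) = x\<^sup>k\<close> give the required infinite family.  The laws depend linearly on \<open>h\<close>, so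
  nontriviality and inequivalence both follow from one statement, \<open>trivial_multiplier_law_imp_zero\<close>:
  if the law with a continuous multiplier \<open>h\<close> is trivial, then \<open>h = 0\<close>.

  Suppose that the law is \<open>P + Q\<close>, where \<open>P\<close> vanishes on the equation and \<open>Q\<close> is identically
  divergence free.  The equation is solved for \<open>u\<^sub>t\<^sub>t\<^sub>t\<close>, so on the slice \<open>t = 0\<close> the values of \<open>u\<close>,
  \<open>u\<^sub>t\<close>, \<open>u\<^sub>t\<^sub>t\<close> can be prescribed; all further \<open>t\<close>-derivatives are then determined recursively by the
  differential consequences of \<open>E = 0\<close> (\<open>solution_jet\<close>).  Take \<open>u = u\<^sub>t = 0\<close> and let \<open>u\<^sub>t\<^sub>t = \<phi>\<close> be a bump
  function of \<open>(x, y)\<close>.  This gives at each point of the slice a jet on which \<open>P\<close> vanishes, so there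
  \<open>Q\<^sub>t\<close> equals the density \<open>a h(x) \<phi>(x, y)\<close>.  No convergent solution is needed: \<open>Q\<close> is divergence free
  on every function, and \<open>P\<close> sees only finitely many derivatives.  Hence the first
  \<open>t\<close>-derivatives on the slice may be extended to an arbitrary smooth function of \<open>(t, x, y)\<close> that is
  compactly supported in \<open>(x, y)\<close> and vanishes for \<open>t > 1\<close> (\<open>time_extension\<close>).  Along it the integral
  of \<open>Q\<^sub>t\<close> over \<open>(x, y)\<close> does not depend on \<open>t\<close> (\<open>conserved_integral\<close>) and is zero at \<open>t = 2\<close>, so
  \<open>\<integral> a h \<phi> = 0\<close>.  Choosing \<open>\<phi>\<close> supported where \<open>h\<close> has a fixed sign forces \<open>h = 0\<close>.

  Two facts link the jet calculus to honest functions.  A total derivative is an ordinary derivative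
  along any curve of jets whose velocity is the formal one (\<open>total_deriv_prolongs\<close>); the sum, product
  and chain rules for total derivatives are consequences.  Total derivatives commute on the algebra
  \<open>jet_alg\<close> that contains \<open>E\<close> and all its differential consequences, which makes the recursion for
  the formal solution consistent.
\<close>

section \<open>Differentiation along curves in the jet space\<close>

lemma tendsto_jet:
  fixes \<gamma> :: "'a::topological_space \<Rightarrow> 'n jet"
  assumes "\<And>c. ((\<lambda>s. \<gamma> s c) \<longlongrightarrow> p c) A"
  shows "(\<gamma> \<longlongrightarrow> p) A"
  using assms
  by (subst limitin_canonical_iff[symmetric], subst euclidean_product_topology[symmetric])
    (simp add: limitin_componentwise)

text \<open>
  The finitely many coordinates on which \<open>F\<close> depends are frozen one at a time at their values at
  \<open>s\<^sub>0\<close>.  The effect of freezing the coordinate \<open>c\<close> is controlled by the mean value theorem in that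
  coordinate and the continuity of \<open>\<partial>F/\<partial>c\<close>; what remains depends on one coordinate fewer.
\<close>

lemma chain_rule_finite:
  fixes F :: "'n jet_fun"
  assumes "finite S" "\<And>p q. (\<forall>c\<in>S. p c = q c) \<Longrightarrow> F p = F q"
    and diff: "\<And>c p. (\<lambda>s. F (p(c := s))) field_differentiable at (p c)"
    and cont: "\<And>c. continuous_on UNIV (partial_deriv c F)"
    and der: "\<And>c. ((\<lambda>s. \<gamma> s c) has_field_derivative \<gamma>' c) (at s0)"
  shows "((\<lambda>s. F (\<gamma> s)) has_field_derivative (\<Sum>c\<in>S. \<gamma>' c * partial_deriv c F (\<gamma> s0))) (at s0)"
  using assms(1-4)
proof (induction S arbitrary: F rule: finite_induct)
  case empty
  have "F (\<gamma> s) = F (\<gamma> s0)" for s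
    by (rule empty.prems) simp
  then have "(\<lambda>s. F (\<gamma> s)) = (\<lambda>s. F (\<gamma> s0))"
    by blast
  then show ?case by simp
next
  case (insert c S)
  define c0 where "c0 = \<gamma> s0 c"
  define F' where "F' = (\<lambda>p. F (p(c := c0)))"
  have F'_deriv_eq: "partial_deriv d F' p = (if d = c then 0 else partial_deriv d F (p(c := c0)))" for d p
    by (auto simp: partial_deriv_def F'_def fun_upd_twist)
  have upd_cont: "continuous_on UNIV (\<lambda>p :: 'n jet. p(c := c0))"
    unfolding continuous_on_def
  proof (intro ballI tendsto_jet)
    fix p :: "'n jet" and d
    have "((\<lambda>q :: 'n jet. q d) \<longlongrightarrow> p d) (at p)"
      using continuous_on_product_coordinates[of d] unfolding continuous_on_def by auto
    then show "((\<lambda>q. (q(c := c0)) d) \<longlongrightarrow> (p(c := c0)) d) (at p within UNIV)"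
      by simp
  qed
  have IH: "((\<lambda>s. F' (\<gamma> s)) has_field_derivative (\<Sum>d\<in>S. \<gamma>' d * partial_deriv d F' (\<gamma> s0))) (at s0)"
  proof (rule insert.IH)
    show "F' p = F' q" if "\<forall>d\<in>S. p d = q d" for p q
      unfolding F'_def using that by (intro insert.prems) auto
    show "(\<lambda>s. F' (p(d := s))) field_differentiable at (p d)" for d p
    proof (cases "d = c")
      case False
      have "(\<lambda>s. F' (p(d := s))) = (\<lambda>s. F ((p(c := c0))(d := s)))"
        unfolding F'_def using fun_upd_twist[OF False] by metis
      moreover have "(\<lambda>s. F ((p(c := c0))(d := s))) field_differentiable at ((p(c := c0)) d)"
        by (rule insert.prems(2))
      moreover have "(p(c := c0)) d = p d"
        using False by simp
      ultimately show ?thesis by metis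
    qed (simp add: F'_def)
    show "continuous_on UNIV (partial_deriv d F')" for d
    proof (cases "d = c")
      case False
      then have "partial_deriv d F' = partial_deriv d F \<circ> (\<lambda>p. p(c := c0))"
        by (auto simp: F'_deriv_eq)
      then show ?thesis
        using continuous_on_compose[OF upd_cont] insert.prems(3)[of d]
        by (metis continuous_on_subset top_greatest)
    next
      case True
      then have "partial_deriv d F' = (\<lambda>_. 0)"
        by (auto simp: F'_deriv_eq)
      then show ?thesis by simp
    qed
  qed
  have same: "(\<gamma> s0)(c := c0) = \<gamma> s0"
    by (auto simp: c0_def)
  have sum_eq: "(\<Sum>d\<in>S. \<gamma>' d * partial_deriv d F' (\<gamma> s0)) = (\<Sum>d\<in>S. \<gamma>' d * partial_deriv d F (\<gamma> s0))"
    using insert.hyps by (intro sum.cong) (auto simp: F'_deriv_eq same)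
  have D: "((\<lambda>s. F (p(c := s))) has_field_derivative partial_deriv c F (p(c := \<sigma>))) (at \<sigma>)" for p \<sigma>
  proof -
    have "(\<lambda>s. F ((p(c := \<sigma>))(c := s))) field_differentiable at ((p(c := \<sigma>)) c)"
      by (rule insert.prems(2))
    then have "(\<lambda>s. F (p(c := s))) field_differentiable at \<sigma>"
      by (simp only: fun_upd_upd fun_upd_same)
    then show ?thesis
      unfolding partial_deriv_def fun_upd_upd fun_upd_same by (rule field_differentiable_derivI)
  qed
  have "\<exists>\<xi>. \<bar>\<xi> - c0\<bar> \<le> \<bar>\<gamma> s c - c0\<bar> \<and>
      F (\<gamma> s) - F' (\<gamma> s) = (\<gamma> s c - c0) * partial_deriv c F ((\<gamma> s)(c := \<xi>))" for s
  proof -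
    let ?k = "\<lambda>\<sigma>. F ((\<gamma> s)(c := \<sigma>))"
    have k: "?k (\<gamma> s c) = F (\<gamma> s)" "?k c0 = F' (\<gamma> s)"
      by (simp_all add: F'_def)
    consider "c0 < \<gamma> s c" | "c0 = \<gamma> s c" | "\<gamma> s c < c0" by linarith
    then show ?thesis
    proof cases
      case 1
      obtain \<xi> where "c0 < \<xi>" "\<xi> < \<gamma> s c"
        "?k (\<gamma> s c) - ?k c0 = (\<gamma> s c - c0) * partial_deriv c F ((\<gamma> s)(c := \<xi>))"
        using MVT2[OF 1, of ?k "\<lambda>\<xi>. partial_deriv c F ((\<gamma> s)(c := \<xi>))"] D by blast
      then show ?thesis unfolding k by (intro exI[of _ \<xi>]) auto
    next
      case 2
      then show ?thesis using k by (intro exI[of _ c0]) auto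
    next
      case 3
      obtain \<xi> where "\<gamma> s c < \<xi>" "\<xi> < c0"
        "?k c0 - ?k (\<gamma> s c) = (c0 - \<gamma> s c) * partial_deriv c F ((\<gamma> s)(c := \<xi>))"
        using MVT2[OF 3, of ?k "\<lambda>\<xi>. partial_deriv c F ((\<gamma> s)(c := \<xi>))"] D by blast
      then show ?thesis unfolding k by (intro exI[of _ \<xi>]) (auto simp: algebra_simps)
    qed
  qed
  \<comment> \<open>The mean value points tend to the frozen value, so the difference quotient can be read off from \<open>\<xi>\<close>.\<close>
  then obtain \<xi> where \<xi>: "\<And>s. \<bar>\<xi> s - c0\<bar> \<le> \<bar>\<gamma> s c - c0\<bar>"
      "\<And>s. F (\<gamma> s) - F' (\<gamma> s) = (\<gamma> s c - c0) * partial_deriv c F ((\<gamma> s)(c := \<xi> s))"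
    by metis
  have lim: "((\<lambda>s. \<gamma> s d) \<longlongrightarrow> \<gamma> s0 d) (at s0)" for d
    using DERIV_isCont[OF der[of d]] by (simp add: isCont_def)
  have "((\<lambda>s. \<bar>\<gamma> s c - c0\<bar>) \<longlongrightarrow> 0) (at s0)"
    using lim[of c] unfolding c0_def by (simp add: LIM_zero tendsto_rabs_zero)
  then have "((\<lambda>s. \<xi> s - c0) \<longlongrightarrow> 0) (at s0)"
    by (rule Lim_null_comparison[rotated]) (simp add: \<xi>(1))
  then have \<xi>_lim: "(\<xi> \<longlongrightarrow> c0) (at s0)"
    by (simp add: LIM_zero_iff)
  have "((\<lambda>s. (\<gamma> s)(c := \<xi> s)) \<longlongrightarrow> \<gamma> s0) (at s0)"
  proof (rule tendsto_jet)
    fix d show "((\<lambda>s. ((\<gamma> s)(c := \<xi> s)) d) \<longlongrightarrow> \<gamma> s0 d) (at s0)"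
      using lim[of d] \<xi>_lim by (cases "d = c") (auto simp: c0_def)
  qed
  then have pd_lim: "((\<lambda>s. partial_deriv c F ((\<gamma> s)(c := \<xi> s))) \<longlongrightarrow> partial_deriv c F (\<gamma> s0)) (at s0)"
    by (rule continuous_on_tendsto_compose[OF insert.prems(3)[of c]]) auto
  have "((\<lambda>s. (\<gamma> s c - \<gamma> s0 c) / (s - s0)) \<longlongrightarrow> \<gamma>' c) (at s0)"
    using der[of c] by (simp add: has_field_derivative_iff)
  from tendsto_mult[OF this pd_lim]
  have "((\<lambda>s. F (\<gamma> s) - F' (\<gamma> s)) has_field_derivative \<gamma>' c * partial_deriv c F (\<gamma> s0)) (at s0)"
    unfolding has_field_derivative_iff \<xi>(2) by (simp add: c0_def)
  from DERIV_add[OF this IH] show ?case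
    unfolding sum_eq using insert.hyps by simp
qed

lemma differential_functionE:
  fixes F :: "'n jet_fun"
  assumes "differential_function F"
  obtains S where "finite S" "\<And>p q. (\<forall>c\<in>S. p c = q c) \<Longrightarrow> F p = F q"
    "\<And>c p. (\<lambda>s. F (p(c := s))) field_differentiable at (p c)"
    "\<And>c. continuous_on UNIV (partial_deriv c F)"
    "continuous_on UNIV F"
proof -
  obtain S where S: "finite S" "\<forall>p q. (\<forall>c\<in>S. p c = q c) \<longrightarrow> F p = F q"
    and cs: "\<And>cs. continuous_on UNIV (fold partial_deriv cs F) \<and>
           (\<forall>p c. (\<lambda>s. fold partial_deriv cs F (p(c := s))) field_differentiable at (p c))"
    using assms unfolding differential_function_def by auto
  show thesis
    using S cs[of "[]"] cs[of "[c]" for c] by (intro that[of S]) auto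
qed

text \<open>
  The velocity of \<open>\<gamma>\<close> at \<open>s\<close> is the vector whose derivation is \<open>D\<^sub>i\<close>.  Besides jets of actual
  functions along a coordinate line this covers curves that have the right velocity at one parameter
  only, such as \<open>flow\<close> below.
\<close>

definition prolongs :: "'n indvar \<Rightarrow> (real \<Rightarrow> 'n jet) \<Rightarrow> real \<Rightarrow> bool" where
  "prolongs i \<gamma> s \<longleftrightarrow>
     (\<forall>k. ((\<lambda>s. \<gamma> s (Ind k)) has_field_derivative (if k = i then 1 else 0)) (at s)) \<and>
     (\<forall>M. ((\<lambda>s. \<gamma> s (U M)) has_field_derivative \<gamma> s (U (add_mset i M))) (at s))"

lemma partial_deriv_outside:
  assumes "\<And>p q. (\<forall>c\<in>S. p c = q c) \<Longrightarrow> F p = F q" "c \<notin> S"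
  shows "partial_deriv c F p = 0"
proof -
  have "F (p(c := s)) = F p" for s
    by (rule assms(1)) (use assms(2) in auto)
  then show ?thesis by (simp add: partial_deriv_def)
qed

lemma finite_jet_indices: "finite S \<Longrightarrow> finite {M. U M \<in> S}"
  by (intro finite_inverse_image) (auto simp: inj_on_def)

lemma total_deriv_eq_sum:
  assumes S: "finite S" "\<And>p q. (\<forall>c\<in>S. p c = q c) \<Longrightarrow> F p = F q"
  shows "total_deriv i F p = partial_deriv (Ind i) F p +
      (\<Sum>M\<in>{M. U M \<in> S}. p (U (add_mset i M)) * partial_deriv (U M) F p)"
proof -
  have "{M. p (U (add_mset i M)) * partial_deriv (U M) F p \<noteq> 0} \<subseteq> {M. U M \<in> S}"
    using partial_deriv_outside[of S F, OF S(2)] by auto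
  from Sum_any.expand_superset[OF finite_jet_indices[OF S(1)] this] show ?thesis
    unfolding total_deriv_def by simp
qed

lemma continuous_on_total_deriv:
  fixes F :: "'n jet_fun"
  assumes "differential_function F"
  shows "continuous_on UNIV (total_deriv i F)"
proof -
  obtain S where S: "finite S" "\<And>p q. (\<forall>c\<in>S. p c = q c) \<Longrightarrow> F p = F q"
    "\<And>c. continuous_on UNIV (partial_deriv c F)"
    using differential_functionE[OF assms] by metis
  have "continuous_on UNIV (\<lambda>p. partial_deriv (Ind i) F p +
      (\<Sum>M\<in>{M. U M \<in> S}. p (U (add_mset i M)) * partial_deriv (U M) F p))"
    by (intro continuous_intros S(3) continuous_on_product_coordinates)
  moreover have "total_deriv i F = (\<lambda>p. partial_deriv (Ind i) F p +
      (\<Sum>M\<in>{M. U M \<in> S}. p (U (add_mset i M)) * partial_deriv (U M) F p))"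
    by (rule ext) (rule total_deriv_eq_sum[OF S(1,2)])
  ultimately show ?thesis by (simp only:)
qed

text \<open>
  The sum that defines \<open>D\<^sub>i F\<close> is the chain rule for \<open>F \<circ> \<gamma>\<close>.
\<close>

lemma total_deriv_prolongs:
  fixes F :: "'n jet_fun"
  assumes F: "differential_function F" and \<gamma>: "prolongs i \<gamma> s"
  shows "((\<lambda>s. F (\<gamma> s)) has_field_derivative total_deriv i F (\<gamma> s)) (at s)"
proof -
  obtain S where S: "finite S" "\<And>p q. (\<forall>c\<in>S. p c = q c) \<Longrightarrow> F p = F q"
    "\<And>c p. (\<lambda>s. F (p(c := s))) field_differentiable at (p c)"
    "\<And>c. continuous_on UNIV (partial_deriv c F)"
    using differential_functionE[OF F] by metis
  define \<gamma>' where "\<gamma>' = (\<lambda>c. case c of Ind k \<Rightarrow> (if k = i then 1 else 0) | U M \<Rightarrow> \<gamma> s (U (add_mset i M)))"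
  have der: "((\<lambda>s. \<gamma> s c) has_field_derivative \<gamma>' c) (at s)" for c
    using \<gamma> unfolding prolongs_def \<gamma>'_def by (cases c) auto
  define J where "J = {M. U M \<in> S}"
  define T where "T = insert (Ind i) S"
  have finJ: "finite J"
    unfolding J_def by (rule finite_jet_indices[OF S(1)])
  have T: "finite T" "\<And>p q. (\<forall>c\<in>T. p c = q c) \<Longrightarrow> F p = F q"
    using S(1,2) unfolding T_def by auto
  have "(\<Sum>c\<in>T. \<gamma>' c * partial_deriv c F (\<gamma> s)) =
        (\<Sum>c\<in>insert (Ind i) (U ` J). \<gamma>' c * partial_deriv c F (\<gamma> s))"
    using T(1) finJ
  proof (intro sum.mono_neutral_right ballI)
    fix c assume "c \<in> T - insert (Ind i) (U ` J)"
    then show "\<gamma>' c * partial_deriv c F (\<gamma> s) = 0"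
      by (cases c) (auto simp: T_def J_def \<gamma>'_def)
  qed (auto simp: T_def J_def)
  also have "\<dots> = partial_deriv (Ind i) F (\<gamma> s) +
      (\<Sum>M\<in>J. \<gamma> s (U (add_mset i M)) * partial_deriv (U M) F (\<gamma> s))"
    using finJ by (subst sum.insert) (auto simp: sum.reindex inj_on_def \<gamma>'_def)
  also have "\<dots> = total_deriv i F (\<gamma> s)"
    unfolding J_def by (rule total_deriv_eq_sum[OF S(1,2), symmetric])
  finally show ?thesis
    using chain_rule_finite[where \<gamma> = \<gamma> and \<gamma>' = \<gamma>', OF T S(3,4) der] by simp
qed

text \<open>
  A straight line through \<open>p\<close> whose velocity at \<open>0\<close> is the one of \<open>D\<^sub>i\<close>.  Since it exists for every
  \<open>p\<close> and \<open>i\<close>, the calculation rules for \<open>D\<^sub>i\<close> are those of the ordinary derivative at \<open>0\<close>.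
\<close>

definition flow :: "'n indvar \<Rightarrow> 'n jet \<Rightarrow> real \<Rightarrow> 'n jet" where
  "flow i p s = (\<lambda>c. case c of Ind k \<Rightarrow> p c + (if k = i then s else 0)
                             | U M \<Rightarrow> p c + s * p (U (add_mset i M)))"

lemma flow_0 [simp]: "flow i p 0 = p"
  by (auto simp: flow_def split: coord.splits)

lemma prolongs_flow: "prolongs i (flow i p) 0"
  unfolding prolongs_def by (auto simp: flow_def intro!: derivative_eq_intros)

lemma has_derivative_flow:
  assumes "differential_function F"
  shows "((\<lambda>s. F (flow i p s)) has_field_derivative total_deriv i F p) (at 0)"
  using total_deriv_prolongs[OF assms prolongs_flow[of i p]] by simp

lemma total_deriv_eqI:
  assumes "differential_function F"
    and "((\<lambda>s. F (flow i p s)) has_field_derivative D) (at 0)"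
  shows "total_deriv i F p = D"
  using DERIV_unique[OF has_derivative_flow[OF assms(1)] assms(2)] .

section \<open>The algebra of elementary differential functions\<close>

text \<open>
  The smallest algebra that contains the coordinates and all \<open>f\<^sup>(\<^sup>k\<^sup>)(u)\<close>.  It is closed under partial
  and total derivatives, so smoothness and \<open>D\<^sub>i D\<^sub>j = D\<^sub>j D\<^sub>i\<close> can be proved on it by induction over
  the generators, without a symmetry theorem for general second derivatives.
\<close>

inductive jet_alg :: "(real \<Rightarrow> real) \<Rightarrow> 'n jet_fun \<Rightarrow> bool" for f where
  const: "jet_alg f (\<lambda>p. r)"
| coord: "jet_alg f (\<lambda>p. p c)"
| comp: "jet_alg f (\<lambda>p. (deriv ^^ k) f (p (U {#})))"
| add: "jet_alg f F \<Longrightarrow> jet_alg f G \<Longrightarrow> jet_alg f (\<lambda>p. F p + G p)"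
| mult: "jet_alg f F \<Longrightarrow> jet_alg f G \<Longrightarrow> jet_alg f (\<lambda>p. F p * G p)"

lemma jet_alg_sum:
  "finite A \<Longrightarrow> (\<And>j. j \<in> A \<Longrightarrow> jet_alg f (F j)) \<Longrightarrow> jet_alg f (\<lambda>p. \<Sum>j\<in>A. F j p)"
  by (induction A rule: finite_induct) (auto intro: jet_alg.intros)

lemma jet_alg_power: "jet_alg f F \<Longrightarrow> jet_alg f (\<lambda>p. F p ^ k)"
  by (induction k) (auto intro: jet_alg.intros)

lemma smooth_real_deriv:
  assumes "smooth_real f"
  shows "((deriv ^^ k) f has_field_derivative (deriv ^^ Suc k) f x) (at x)"
  using assms unfolding smooth_real_def by (auto intro: field_differentiable_derivI)

text \<open>
  The partial derivatives are produced together with their membership in the algebra, so that the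
  statement can be iterated.
\<close>

lemma jet_alg_C1:
  fixes F :: "'n jet_fun"
  assumes f: "smooth_real f" and F: "jet_alg f F"
  shows "(\<exists>S. finite S \<and> (\<forall>p q. (\<forall>c\<in>S. p c = q c) \<longrightarrow> F p = F q)) \<and>
    continuous_on UNIV F \<and>
    (\<forall>c. \<exists>F'. jet_alg f F' \<and> (\<forall>p. ((\<lambda>s. F (p(c := s))) has_field_derivative F' p) (at (p c))))"
  using F
proof induction
  case (const r)
  show ?case
    by (auto intro!: exI[of _ "\<lambda>_. 0"] jet_alg.const)
next
  case (coord c)
  show ?case
  proof (intro conjI allI)
    fix d
    show "\<exists>F'. jet_alg f F' \<and> (\<forall>p. ((\<lambda>s. (p(d := s)) c) has_field_derivative F' p) (at (p d)))"
      by (intro exI[of _ "\<lambda>_. if c = d then 1 else 0"])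
        (auto intro!: jet_alg.const derivative_eq_intros)
  qed (auto intro!: exI[of _ "{c}"])
next
  case (comp k)
  have cont: "continuous_on UNIV ((deriv ^^ k) f)"
    using smooth_real_deriv[OF f, of k] by (metis DERIV_isCont continuous_at_imp_continuous_on)
  show ?case
  proof (intro conjI allI)
    fix d :: "'n coord"
    show "\<exists>F'. jet_alg f F' \<and> (\<forall>p. ((\<lambda>s. (deriv ^^ k) f ((p(d := s)) (U {#}))) has_field_derivative F' p) (at (p d)))"
    proof (cases "d = U {#}")
      case True
      then show ?thesis
        using smooth_real_deriv[OF f, of k] jet_alg.comp[of f "Suc k"] 
        by (intro exI[of _ "\<lambda>p. (deriv ^^ Suc k) f (p (U {#}))"]) auto
    qed (auto intro!: exI[of _ "\<lambda>_. 0"] jet_alg.const)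
  qed (auto intro!: exI[of _ "{U {#}}"] continuous_on_compose2[OF cont])
next
  case (add F G)
  show ?case
  proof (intro conjI allI)
    show "\<exists>S. finite S \<and> (\<forall>p q. (\<forall>c\<in>S. p c = q c) \<longrightarrow> F p + G p = F q + G q)"
      using add.IH by (metis Un_iff finite_UnI)
    show "continuous_on UNIV (\<lambda>p. F p + G p)"
      using add.IH by (auto intro: continuous_intros)
    fix c
    from add.IH obtain F' G' where "jet_alg f F'" "jet_alg f G'"
      "\<And>p. ((\<lambda>s. F (p(c := s))) has_field_derivative F' p) (at (p c))"
      "\<And>p. ((\<lambda>s. G (p(c := s))) has_field_derivative G' p) (at (p c))"
      by blast
    then show "\<exists>F'. jet_alg f F' \<and> (\<forall>p. ((\<lambda>s. F (p(c := s)) + G (p(c := s))) has_field_derivative F' p) (at (p c)))"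
      by (intro exI[of _ "\<lambda>p. F' p + G' p"]) (auto intro: jet_alg.add DERIV_add)
  qed
next
  case (mult F G)
  show ?case
  proof (intro conjI allI)
    show "\<exists>S. finite S \<and> (\<forall>p q. (\<forall>c\<in>S. p c = q c) \<longrightarrow> F p * G p = F q * G q)"
      using mult.IH by (metis Un_iff finite_UnI)
    show "continuous_on UNIV (\<lambda>p. F p * G p)"
      using mult.IH by (auto intro: continuous_intros)
    fix c
    from mult.IH obtain F' G' where FG: "jet_alg f F'" "jet_alg f G'"
      "\<And>p. ((\<lambda>s. F (p(c := s))) has_field_derivative F' p) (at (p c))"
      "\<And>p. ((\<lambda>s. G (p(c := s))) has_field_derivative G' p) (at (p c))"
      by blast
    have "((\<lambda>s. F (p(c := s)) * G (p(c := s))) has_field_derivative F' p * G p + G' p * F p) (at (p c))" for p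
      using DERIV_mult[OF FG(3,4)[of p]] by simp
    then show "\<exists>F'. jet_alg f F' \<and> (\<forall>p. ((\<lambda>s. F (p(c := s)) * G (p(c := s))) has_field_derivative F' p) (at (p c)))"
      using mult.hyps FG by (intro exI[of _ "\<lambda>p. F' p * G p + G' p * F p"]) (auto intro: jet_alg.intros)
  qed
qed

lemma jet_alg_differential_function:
  fixes F :: "'n jet_fun"
  assumes f: "smooth_real f" and F: "jet_alg f F"
  shows "differential_function F"
proof -
  have step: "jet_alg f (partial_deriv c G)" if G: "jet_alg f G" for c and G :: "'n jet_fun"
  proof -
    obtain G' where G': "jet_alg f G'" "\<And>p. ((\<lambda>s. G (p(c := s))) has_field_derivative G' p) (at (p c))"
      using jet_alg_C1[OF f G] by blast
    have "partial_deriv c G = G'"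
      using G'(2) by (auto simp: partial_deriv_def DERIV_imp_deriv)
    then show ?thesis using G'(1) by simp
  qed
  have alg: "jet_alg f (fold partial_deriv cs F)" for cs
    using F by (induction cs arbitrary: F) (auto intro: step)
  show ?thesis
    unfolding differential_function_def field_differentiable_def
    using jet_alg_C1[OF f alg] jet_alg_C1[OF f F] by meson
qed

context
  fixes f :: "real \<Rightarrow> real"
  assumes f: "smooth_real f"
begin

lemmas jet_alg_smooth = jet_alg_differential_function[OF f]

lemma total_deriv_const: "total_deriv i (\<lambda>p. r) = (\<lambda>p. 0)"
  by (intro ext total_deriv_eqI jet_alg_smooth jet_alg.const) simp

lemma total_deriv_coord:
  "total_deriv i (\<lambda>p. p (U M)) = (\<lambda>p. p (U (add_mset i M)))"
  "total_deriv i (\<lambda>p. p (Ind k)) = (\<lambda>p. if k = i then 1 else 0)"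
  by (intro ext total_deriv_eqI jet_alg_smooth jet_alg.coord; auto simp: flow_def intro!: derivative_eq_intros)+

lemma total_deriv_comp:
  fixes i :: "'n indvar"
  shows "total_deriv i (\<lambda>p. (deriv ^^ k) f (p (U {#}))) = (\<lambda>p. (deriv ^^ Suc k) f (p (U {#})) * p (U {#i#}))"
proof (intro ext total_deriv_eqI jet_alg_smooth jet_alg.comp)
  fix p :: "'n jet"
  have "((\<lambda>s. flow i p s (U {#})) has_field_derivative p (U {#i#})) (at 0)"
    by (auto simp: flow_def intro!: derivative_eq_intros)
  from DERIV_chain2[where f = "(deriv ^^ k) f", OF smooth_real_deriv[OF f] this]
  show "((\<lambda>s. (deriv ^^ k) f (flow i p s (U {#}))) has_field_derivative
     (deriv ^^ Suc k) f (p (U {#})) * p (U {#i#})) (at 0)"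
    by simp
qed

lemma total_deriv_add:
  assumes "jet_alg f F" "jet_alg f G"
  shows "total_deriv i (\<lambda>p. F p + G p) = (\<lambda>p. total_deriv i F p + total_deriv i G p)"
  using assms by (intro ext total_deriv_eqI jet_alg_smooth jet_alg.add DERIV_add has_derivative_flow)

lemma total_deriv_mult:
  assumes "jet_alg f F" "jet_alg f G"
  shows "total_deriv i (\<lambda>p. F p * G p) = (\<lambda>p. total_deriv i F p * G p + total_deriv i G p * F p)"
proof (intro ext total_deriv_eqI jet_alg_smooth jet_alg.mult assms)
  fix p
  show "((\<lambda>s. F (flow i p s) * G (flow i p s)) has_field_derivative
     total_deriv i F p * G p + total_deriv i G p * F p) (at 0)"
    using DERIV_mult[OF has_derivative_flow has_derivative_flow, OF jet_alg_smooth jet_alg_smooth, OF assms, of i p i p]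
    by simp
qed

lemma jet_alg_total_deriv:
  assumes "jet_alg f F"
  shows "jet_alg f (total_deriv i F)"
  using assms
proof induction
  case (coord c)
  then show ?case by (cases c) (simp_all add: total_deriv_coord jet_alg.intros)
next
  case (comp k)
  show ?case unfolding total_deriv_comp by (intro jet_alg.intros)
qed (simp_all add: total_deriv_const total_deriv_add total_deriv_mult jet_alg.intros)

text \<open>
  Both sides are evaluated on the generators, where they agree because multisets do not record the
  order of differentiation; the product rule then spreads the identity over the algebra.
\<close>

lemma total_deriv_commute:
  assumes "jet_alg f F"
  shows "total_deriv i (total_deriv j F) = total_deriv j (total_deriv i F)"
  using assms
proof induction
  case (const r)
  then show ?case by (simp add: total_deriv_const)
next
  case (coord c)
  then show ?case by (cases c) (simp_all add: total_deriv_coord total_deriv_const add_mset_commute)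
next
  case (comp k)
  show ?case
    unfolding total_deriv_comp total_deriv_mult[OF jet_alg.comp jet_alg.coord] total_deriv_coord
    by (simp add: add_mset_commute mult_ac)
next
  case (add F G)
  then show ?case by (simp add: total_deriv_add jet_alg_total_deriv)
next
  case (mult F G)
  then show ?case
    by (simp add: total_deriv_mult total_deriv_add jet_alg_total_deriv jet_alg.intros)
      (simp add: algebra_simps)
qed

lemma total_deriv_sum:
  assumes "finite A" "\<And>j. j \<in> A \<Longrightarrow> jet_alg f (F j)"
  shows "total_deriv i (\<lambda>p. \<Sum>j\<in>A. F j p) = (\<lambda>p. \<Sum>j\<in>A. total_deriv i (F j) p)"
  using assms
  by (induction A rule: finite_induct)
    (simp_all add: total_deriv_const total_deriv_add jet_alg_sum)

lemma total_deriv_cmult: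
  assumes "jet_alg f F"
  shows "total_deriv i (\<lambda>p. r * F p) = (\<lambda>p. r * total_deriv i F p)"
  using assms by (simp add: total_deriv_mult total_deriv_const jet_alg.const mult.commute)

end

section \<open>Smooth functions of one variable\<close>

lemma smooth_real_iterated:
  assumes "\<And>k x. (F k has_field_derivative F (Suc k) x) (at x)"
  shows "smooth_real (F 0)" "(deriv ^^ k) (F 0) = F k"
proof -
  have eq: "(deriv ^^ k) (F 0) = F k" for k
    by (induction k) (use assms in \<open>auto intro!: DERIV_imp_deriv\<close>)
  then show "(deriv ^^ k) (F 0) = F k" .
  show "smooth_real (F 0)"
    unfolding smooth_real_def eq field_differentiable_def using assms by blast
qed

text \<open>
  The iterated derivatives of \<open>f g\<close> stay in this span, which replaces an explicit Leibniz formula.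
\<close>

inductive product_span :: "(real \<Rightarrow> real) \<Rightarrow> (real \<Rightarrow> real) \<Rightarrow> (real \<Rightarrow> real) \<Rightarrow> bool" for f g where
  gen: "product_span f g (\<lambda>x. (deriv ^^ i) f x * (deriv ^^ j) g x)"
| add: "product_span f g h \<Longrightarrow> product_span f g k \<Longrightarrow> product_span f g (\<lambda>x. h x + k x)"

lemma smooth_real_mult:
  assumes f: "smooth_real f" and g: "smooth_real g"
  shows "smooth_real (\<lambda>x. f x * g x)"
proof -
  have step: "\<exists>h'. product_span f g h' \<and> (\<forall>x. (h has_field_derivative h' x) (at x))"
    if "product_span f g h" for h
    using that
  proof induction
    case (gen i j)
    have "((\<lambda>x. (deriv ^^ i) f x * (deriv ^^ j) g x) has_field_derivative
       (deriv ^^ Suc i) f x * (deriv ^^ j) g x + (deriv ^^ i) f x * (deriv ^^ Suc j) g x) (at x)" for x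
      using DERIV_mult[OF smooth_real_deriv[OF f, of i x] smooth_real_deriv[OF g, of j x]]
      by (simp add: mult.commute)
    then show ?case
      using product_span.add[OF product_span.gen[of f g "Suc i" j] product_span.gen[of f g i "Suc j"]]
      by blast
  next
    case (add h k)
    then show ?case by (blast intro: product_span.add DERIV_add)
  qed
  have "product_span f g (deriv h) \<and> (\<forall>x. h field_differentiable at x)" if h: "product_span f g h" for h
  proof -
    obtain h' where h': "product_span f g h'" "\<And>x. (h has_field_derivative h' x) (at x)"
      using step[OF h] by blast
    then have "deriv h = h'" by (auto intro: DERIV_imp_deriv)
    then show ?thesis using h' field_differentiable_def by blast
  qed
  moreover have "product_span f g (\<lambda>x. f x * g x)"
    using product_span.gen[of f g 0 0] by simp
  ultimately have "product_span f g ((deriv ^^ k) (\<lambda>x. f x * g x))" for k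
    by (induction k) auto
  then show ?thesis
    unfolding smooth_real_def
    using \<open>\<And>h. product_span f g h \<Longrightarrow> product_span f g (deriv h) \<and> (\<forall>x. h field_differentiable at x)\<close> by blast
qed

lemma smooth_real_lincomb:
  assumes f: "smooth_real f" and g: "smooth_real g"
  shows "smooth_real (\<lambda>x. f x + r * g x)"
    "(deriv ^^ k) (\<lambda>x. f x + r * g x) = (\<lambda>x. (deriv ^^ k) f x + r * (deriv ^^ k) g x)"
proof -
  define F where "F = (\<lambda>k x. (deriv ^^ k) f x + r * (deriv ^^ k) g x)"
  have "(F k has_field_derivative F (Suc k) x) (at x)" for k x
    unfolding F_def by (intro DERIV_add DERIV_cmult smooth_real_deriv assms)
  from smooth_real_iterated[of F, OF this]
  show "smooth_real (\<lambda>x. f x + r * g x)"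
    "(deriv ^^ k) (\<lambda>x. f x + r * g x) = (\<lambda>x. (deriv ^^ k) f x + r * (deriv ^^ k) g x)"
    by (simp_all add: F_def)
qed

lemma smooth_real_affine:
  assumes f: "smooth_real f"
  shows "smooth_real (\<lambda>x. f (r * x + d))"
proof -
  define F where "F = (\<lambda>k x. r ^ k * (deriv ^^ k) f (r * x + d))"
  have "(F k has_field_derivative F (Suc k) x) (at x)" for k x
  proof -
    have "((\<lambda>x. r * x + d) has_field_derivative r) (at x)"
      by (auto intro!: derivative_eq_intros)
    from DERIV_cmult[OF DERIV_chain2[OF smooth_real_deriv[OF f] this], of "r ^ k"]
    show ?thesis
      by (simp add: F_def mult_ac)
  qed
  from smooth_real_iterated(1)[of F, OF this] show ?thesis by (simp add: F_def)
qed

lemma smooth_real_power: "smooth_real (\<lambda>x. x ^ n)"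
proof (induction n)
  case 0
  show ?case
    using smooth_real_iterated(1)[of "\<lambda>k x. if k = 0 then 1 else 0"] by simp
next
  case (Suc n)
  define F :: "nat \<Rightarrow> real \<Rightarrow> real"
    where "F = (\<lambda>k. if k = 0 then (\<lambda>x. x) else if k = 1 then (\<lambda>x. 1) else (\<lambda>x. 0))"
  have "smooth_real (F 0)"
    by (rule smooth_real_iterated) (auto simp: F_def)
  from smooth_real_mult[OF this Suc] show ?case by (simp add: F_def)
qed

lemma smooth_real_DERIV: "smooth_real f \<Longrightarrow> (f has_field_derivative deriv f x) (at x)"
  using smooth_real_deriv[of f 0] by simp

lemma smooth_real_deriv_smooth: "smooth_real f \<Longrightarrow> smooth_real (deriv f)"
  unfolding smooth_real_def by (metis comp_apply funpow_Suc_right)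

lemma iterated_deriv_eq_0:
  assumes "open T" "\<And>x. x \<in> T \<Longrightarrow> f x = 0" "x \<in> T"
  shows "(deriv ^^ k) f x = (0 :: real)"
  using assms(3)
proof (induction k arbitrary: x)
  case (Suc k)
  have "eventually (\<lambda>y. (deriv ^^ k) f y = 0) (nhds x)"
    using Suc assms(1) eventually_nhds by blast
  then have "deriv ((deriv ^^ k) f) x = deriv (\<lambda>_. 0) x"
    by (intro deriv_cong_ev) auto
  then show ?case by simp
qed (use assms in simp)

text \<open>
  The standard smooth function that is positive exactly on the positive half-line.
\<close>

definition flat_exp :: "real \<Rightarrow> real" where
  "flat_exp x = (if x > 0 then exp (- 1 / x) else 0)"

lemma flat_exp_smooth: "smooth_real flat_exp"
proof -
  \<comment> \<open>The \<open>k\<close>-th derivative is \<open>p\<^sub>k(1/x) exp(-1/x)\<close> for \<open>x > 0\<close>; differentiation maps \<open>q\<close> to \<open>X\<^sup>2 (q - q')\<close>.\<close>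
  define p :: "nat \<Rightarrow> real poly" where
    "p = rec_nat 1 (\<lambda>_ p. monom 1 2 * (p - pderiv p))"
  have p_Suc: "p (Suc k) = monom 1 2 * (p k - pderiv (p k))" and p_0: "p 0 = 1" for k
    by (simp_all add: p_def)
  define F where "F = (\<lambda>k x. if x > 0 then poly (p k) (1 / x) * exp (- 1 / x) else (0 :: real))"
  have pos: "((\<lambda>x. poly q (1 / x) * exp (- 1 / x)) has_field_derivative
      poly (monom 1 2 * (q - pderiv q)) (1 / x) * exp (- 1 / x)) (at x)" if "x > 0" for q and x :: real
  proof -
    have "((\<lambda>x. 1 / x) has_field_derivative - ((1 / x)\<^sup>2)) (at x)"
      using that by (auto intro!: derivative_eq_intros simp: power2_eq_square)
    from DERIV_chain2[OF poly_DERIV this]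
    have 1: "((\<lambda>x. poly q (1 / x)) has_field_derivative poly (pderiv q) (1 / x) * - ((1 / x)\<^sup>2)) (at x)" .
    have 2: "((\<lambda>x. exp (- 1 / x)) has_field_derivative exp (- 1 / x) * (1 / x)\<^sup>2) (at x)"
      using that by (auto intro!: derivative_eq_intros simp: power2_eq_square)
    from DERIV_mult[OF 1 2] show ?thesis
      by (simp add: poly_monom algebra_simps)
  qed
  have lim: "((\<lambda>x. poly q (1 / x) * exp (- 1 / x)) \<longlongrightarrow> 0) (at_right 0)" for q :: "real poly"
  proof -
    have "((\<lambda>y. y ^ n * poly q y / exp y) \<longlongrightarrow> 0) at_top" for n
    proof (induction q arbitrary: n)
      case (pCons r q)
      have "((\<lambda>y. r * (y ^ n / exp y) + y ^ Suc n * poly q y / exp y) \<longlongrightarrow> r * 0 + 0) at_top"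
        by (intro tendsto_intros tendsto_power_div_exp_0 pCons.IH)
      then show ?case by (simp add: algebra_simps add_divide_distrib)
    qed simp
    from this[of 0] have "((\<lambda>y. poly q y / exp y) \<longlongrightarrow> 0) at_top"
      by simp
    from filterlim_compose[OF this filterlim_inverse_at_top_right] show ?thesis
      by (simp add: exp_minus divide_inverse)
  qed
  have "(F k has_field_derivative F (Suc k) x) (at x)" for k x
  proof -
    consider "x > 0" | "x < 0" | "x = 0" by linarith
    then show ?thesis
    proof cases
      case 1
      have "((\<lambda>x. poly (p k) (1 / x) * exp (- 1 / x)) has_field_derivative F (Suc k) x) (at x)"
        using pos[OF 1, of "p k"] 1 unfolding F_def p_Suc by simp
      moreover have "\<forall>y\<in>{0<..}. poly (p k) (1 / y) * exp (- 1 / y) = F k y"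
        by (simp add: F_def)
      ultimately show ?thesis
        using has_field_derivative_transform_within_open[of _ _ x "{0<..}" "F k"] 1 by auto
    next
      case 2
      have "((\<lambda>_. 0) has_field_derivative F (Suc k) x) (at x)"
        using 2 by (simp add: F_def)
      moreover have "\<forall>y\<in>{..<0}. 0 = F k y"
        by (simp add: F_def)
      ultimately show ?thesis
        using has_field_derivative_transform_within_open[of "\<lambda>_. 0" _ x "{..<0}" "F k"] 2 by auto
    next
      case 3
      have "((\<lambda>y. (F k y - F k 0) / (y - 0)) \<longlongrightarrow> 0) (at_right 0)"
      proof (rule tendsto_cong[THEN iffD1])
        show "((\<lambda>y. poly (pCons 0 (p k)) (1 / y) * exp (- 1 / y)) \<longlongrightarrow> 0) (at_right 0)"
          by (rule lim)
        show "eventually (\<lambda>y. poly (pCons 0 (p k)) (1 / y) * exp (- 1 / y) = (F k y - F k 0) / (y - 0)) (at_right 0)"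
          by (auto simp: eventually_at_filter F_def)
      qed
      moreover have "((\<lambda>y. (F k y - F k 0) / (y - 0)) \<longlongrightarrow> 0) (at_left 0)"
        by (rule tendsto_eventually) (auto simp: eventually_at_filter F_def)
      ultimately show ?thesis
        unfolding 3 has_field_derivative_iff by (simp add: filterlim_split_at F_def)
    qed
  qed
  moreover have "F 0 = flat_exp"
    by (auto simp: F_def p_0 flat_exp_def)
  ultimately show ?thesis
    using smooth_real_iterated(1)[of F] by simp
qed

text \<open>
  The first \<open>n\<close> derivatives see \<open>t\<^sup>n \<psi>\<close> as \<open>\<psi>(0) t\<^sup>n\<close>, so these functions give a triangular system for
  the derivatives at \<open>0\<close>.
\<close>

lemma deriv_power_mult_at_0:
  assumes "smooth_real \<psi>" "m \<le> n"
  shows "(deriv ^^ m) (\<lambda>t. t ^ n * \<psi> t) 0 = (if m = n then fact n * \<psi> 0 else 0)"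
  using assms
proof (induction m arbitrary: n \<psi>)
  case 0
  then show ?case by simp
next
  case (Suc m)
  from Suc.prems obtain n' where n': "n = Suc n'" by (cases n) auto
  have sm: "smooth_real (\<lambda>t. t ^ k * \<psi>' t)" if "smooth_real \<psi>'" for k \<psi>'
    by (intro smooth_real_mult smooth_real_power that)
  have "((\<lambda>t. t ^ n * \<psi> t) has_field_derivative t ^ n * deriv \<psi> t + real n * (t ^ n' * \<psi> t)) (at t)" for t
    using DERIV_mult[OF DERIV_pow[of n t] smooth_real_DERIV[OF Suc.prems(1), of t]]
    by (simp add: n' algebra_simps)
  then have "deriv (\<lambda>t. t ^ n * \<psi> t) = (\<lambda>t. t ^ n * deriv \<psi> t + real n * (t ^ n' * \<psi> t))"
    by (auto intro: DERIV_imp_deriv)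
  then have "(deriv ^^ Suc m) (\<lambda>t. t ^ n * \<psi> t) 0 =
      (deriv ^^ m) (\<lambda>t. t ^ n * deriv \<psi> t) 0 + real n * (deriv ^^ m) (\<lambda>t. t ^ n' * \<psi> t) 0"
    unfolding funpow_Suc_right comp_apply
    by (simp add: smooth_real_lincomb(2) sm Suc.prems smooth_real_deriv_smooth)
  also have "\<dots> = (if Suc m = n then fact n * \<psi> 0 else 0)"
    using Suc.IH[of "deriv \<psi>" n] Suc.IH[of \<psi> n'] Suc.prems n'
    by (auto simp: smooth_real_deriv_smooth)
  finally show ?case .
qed

text \<open>
  A finite form of Borel's theorem.  The derivatives are corrected one after the other by multiples of
  \<open>t\<^sup>k \<psi>\<close>, which leave the lower ones unchanged, where \<open>\<psi>\<close> vanishes for \<open>t > 1\<close> but not at \<open>0\<close>.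
\<close>

lemma prescribed_jet:
  "\<exists>g. smooth_real g \<and> (\<forall>t>1. g t = 0) \<and> (\<forall>m\<le>n. (deriv ^^ m) g 0 = c m)"
proof -
  define \<psi> where "\<psi> = (\<lambda>t. flat_exp (-1 * t + 1))"
  have \<psi>: "smooth_real \<psi>" "\<psi> 0 > 0" "\<And>t. t > 1 \<Longrightarrow> \<psi> t = 0"
    unfolding \<psi>_def by (intro smooth_real_affine flat_exp_smooth) (auto simp: flat_exp_def)
  have "\<exists>g. smooth_real g \<and> (\<forall>t>1. g t = 0) \<and> (\<forall>m<n. (deriv ^^ m) g 0 = c m)" for n
  proof (induction n)
    case 0
    then show ?case using \<psi> by auto
  next
    case (Suc n)
    then obtain g where g: "smooth_real g" "\<forall>t>1. g t = 0" "\<forall>m<n. (deriv ^^ m) g 0 = c m"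
      by blast
    have "fact n * \<psi> 0 \<noteq> 0"
      using \<psi>(2) by simp
    moreover define r where "r = (c n - (deriv ^^ n) g 0) / (fact n * \<psi> 0)"
    ultimately have r: "r * (fact n * \<psi> 0) = c n - (deriv ^^ n) g 0"
      by (simp add: r_def)
    have sm: "smooth_real (\<lambda>t. t ^ n * \<psi> t)"
      by (intro smooth_real_mult smooth_real_power \<psi>)
    show ?case
    proof (intro exI[of _ "\<lambda>t. g t + r * (t ^ n * \<psi> t)"] conjI allI impI)
      show "(deriv ^^ m) (\<lambda>t. g t + r * (t ^ n * \<psi> t)) 0 = c m" if "m < Suc n" for m
        using that g(3) r unfolding smooth_real_lincomb(2)[OF g(1) sm]
        by (auto simp: deriv_power_mult_at_0[OF \<psi>(1)] less_Suc_eq)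
    qed (use g \<psi> sm in \<open>auto intro: smooth_real_lincomb\<close>)
  qed
  from this[of "Suc n"] show ?thesis by (simp add: less_Suc_eq_le)
qed

lemma bump_function:
  fixes \<alpha> \<beta> :: real
  obtains B where "smooth_real B" "\<And>x. \<alpha> < x \<Longrightarrow> x < \<beta> \<Longrightarrow> B x > 0" "\<And>x. x \<notin> {\<alpha><..<\<beta>} \<Longrightarrow> B x = 0"
proof
  define B where "B = (\<lambda>x. flat_exp (1 * x + (- \<alpha>)) * flat_exp (-1 * x + \<beta>))"
  show "smooth_real B"
    unfolding B_def by (intro smooth_real_mult smooth_real_affine flat_exp_smooth)
qed (auto simp: flat_exp_def)

section \<open>Integrals of conserved densities\<close>

text \<open>
  The integral of \<open>G(z + s e)\<close> over the whole space does not depend on \<open>s\<close>, so its difference quotients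
  vanish; by dominated convergence they tend to the integral of \<open>G'\<close>.  Boundary terms never appear.
\<close>

lemma integral_directional_derivative_eq_0:
  fixes G G' :: "'a::euclidean_space \<Rightarrow> real" and e :: 'a
  assumes der: "\<And>z s. ((\<lambda>s. G (z + s *\<^sub>R e)) has_field_derivative G' (z + s *\<^sub>R e)) (at s)"
    and cont: "continuous_on UNIV G" "continuous_on UNIV G'"
    and supp: "\<And>z. z \<notin> cbox c d \<Longrightarrow> G z = 0"
  shows "integral (cbox c d) G' = 0"
proof -
  have supp': "G' z = 0" if "z \<notin> cbox c d" for z
  proof -
    have "open (- cbox c d)"
      by (simp add: closed_cbox open_Compl)
    then have "eventually (\<lambda>y. y \<in> - cbox c d) (nhds z)"
      using that by (intro eventually_nhds_in_open) auto
    moreover have "((\<lambda>s. z + s *\<^sub>R e) \<longlongrightarrow> z + 0 *\<^sub>R e) (nhds 0)"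
      by (intro tendsto_intros filterlim_ident)
    then have "((\<lambda>s. z + s *\<^sub>R e) \<longlongrightarrow> z) (nhds 0)"
      by simp
    ultimately have "eventually (\<lambda>s. z + s *\<^sub>R e \<in> - cbox c d) (nhds 0)"
      by (rule eventually_compose_filterlim)
    then have "eventually (\<lambda>s. G (z + s *\<^sub>R e) = 0) (nhds 0)"
      by eventually_elim (simp add: supp)
    then have "((\<lambda>s. G (z + s *\<^sub>R e)) has_field_derivative 0) (at 0)"
      by (subst DERIV_cong_ev[OF refl _ refl, where g = "\<lambda>_. 0"]) auto
    from DERIV_unique[OF der[of z 0] this] show ?thesis by simp
  qed
  \<comment> \<open>A compact set that contains the supports of all difference quotients with step at most \<open>1\<close>.\<close>
  define K where "K = (\<lambda>(z, s). z - s *\<^sub>R e) ` (cbox c d \<times> {0..1})"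
  have "compact K"
    unfolding K_def
    by (intro compact_continuous_image compact_Times compact_cbox compact_Icc)
      (auto simp: split_beta intro!: continuous_intros)
  have "bounded (G' ` cbox c d)"
    by (intro compact_imp_bounded compact_continuous_image compact_cbox continuous_on_subset[OF cont(2)]) auto
  then obtain C where C: "\<And>z. z \<in> cbox c d \<Longrightarrow> \<bar>G' z\<bar> \<le> C" "C > 0"
    unfolding bounded_pos by auto
  have C': "\<bar>G' z\<bar> \<le> C" for z
    using C supp'[of z] by (cases "z \<in> cbox c d") auto
  define r where "r = (\<lambda>n. 1 / real (Suc n))"
  have r: "0 < r n" "r n \<le> 1" for n
    by (auto simp: r_def)
  define H where "H = (\<lambda>n z. (G (z + r n *\<^sub>R e) - G z) / r n)"
  have meas: "G \<in> borel_measurable borel" "G' \<in> borel_measurable borel"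
    using cont by (auto intro: borel_measurable_continuous_onI)
  have int_G: "integrable lborel G"
  proof -
    have "integrable lborel (\<lambda>z. indicator (cbox c d) z *\<^sub>R G z)"
      using cont(1) by (intro borel_integrable_compact compact_cbox) (auto intro: continuous_on_subset)
    moreover have "(\<lambda>z. indicator (cbox c d) z *\<^sub>R G z) = G"
      by (rule ext) (auto simp: indicator_def of_bool_def supp)
    ultimately show ?thesis by simp
  qed
  have shift: "integrable lborel (\<lambda>z. G (z + v))" "(\<integral>z. G (z + v) \<partial>lborel) = (\<integral>z. G z \<partial>lborel)" for v
  proof -
    have d: "distr lborel borel ((+) v) = (lborel :: 'a measure)"
      by (rule lborel_distr_plus)
    have "integrable (distr lborel borel ((+) v)) G"
      using int_G by (simp add: d)
    then show "integrable lborel (\<lambda>z. G (z + v))"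
      using meas by (subst (asm) integrable_distr_eq) (auto simp: add.commute)
    have "(\<integral>z. G z \<partial>lborel) = (\<integral>z. G z \<partial>distr lborel borel ((+) v))"
      by (simp add: d)
    also have "\<dots> = (\<integral>z. G (v + z) \<partial>lborel)"
      using meas by (subst integral_distr) auto
    finally show "(\<integral>z. G (z + v) \<partial>lborel) = (\<integral>z. G z \<partial>lborel)"
      by (simp add: add.commute)
  qed
  have int_H: "(\<integral>z. H n z \<partial>lborel) = 0" for n
    unfolding H_def using shift int_G by simp
  have "(\<lambda>n. \<integral>z. H n z \<partial>lborel) \<longlonglongrightarrow> (\<integral>z. G' z \<partial>lborel)"
  proof (rule integral_dominated_convergence[where w = "\<lambda>z. indicator (K \<union> cbox c d) z *\<^sub>R C"])
    show "integrable lborel (\<lambda>z. indicator (K \<union> cbox c d) z *\<^sub>R C)"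
      by (intro borel_integrable_compact compact_Un \<open>compact K\<close> compact_cbox) auto
    show "H n \<in> borel_measurable lborel" for n
      using shift(1)[of "r n *\<^sub>R e"] int_G unfolding H_def by auto
    show "AE z in lborel. (\<lambda>n. H n z) \<longlonglongrightarrow> G' z"
    proof (rule AE_I2)
      fix z
      have "((\<lambda>s. (G (z + s *\<^sub>R e) - G z) / s) \<longlongrightarrow> G' z) (at 0)"
        using der[of z 0] by (simp add: has_field_derivative_iff)
      moreover have "filterlim r (at 0) sequentially"
        unfolding filterlim_at using r(1) LIMSEQ_Suc[OF lim_1_over_n]
        by (auto simp: r_def less_imp_neq[THEN not_sym])
      ultimately show "(\<lambda>n. H n z) \<longlonglongrightarrow> G' z"
        unfolding H_def by (rule filterlim_compose)
    qed
    show "AE z in lborel. norm (H n z) \<le> indicator (K \<union> cbox c d) z *\<^sub>R C" for n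
    proof (rule AE_I2)
      fix z
      show "norm (H n z) \<le> indicator (K \<union> cbox c d) z *\<^sub>R C"
      proof (cases "z \<in> K \<union> cbox c d")
        case False
        have "z + r n *\<^sub>R e \<notin> cbox c d"
        proof
          assume "z + r n *\<^sub>R e \<in> cbox c d"
          then have "(z + r n *\<^sub>R e) - r n *\<^sub>R e \<in> K"
            unfolding K_def using r[of n] by (intro image_eqI[of _ _ "(z + r n *\<^sub>R e, r n)"]) auto
          then show False using False by simp
        qed
        then show ?thesis using False supp by (simp add: H_def)
      next
        case True
        obtain \<xi> where "G (z + r n *\<^sub>R e) - G (z + 0 *\<^sub>R e) = (r n - 0) * G' (z + \<xi> *\<^sub>R e)"
          using MVT2[OF r(1)[of n], of "\<lambda>s. G (z + s *\<^sub>R e)" "\<lambda>s. G' (z + s *\<^sub>R e)"] der by blast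
        then have "H n z = G' (z + \<xi> *\<^sub>R e)"
          using r(1)[of n] by (simp add: H_def)
        then show ?thesis using True C' by simp
      qed
    qed
  qed (use meas in auto)
  then have 0: "(\<integral>z. G' z \<partial>lborel) = 0"
    unfolding int_H using LIMSEQ_unique tendsto_const by blast
  have "integrable lborel (\<lambda>z. indicator (cbox c d) z *\<^sub>R G' z)"
    using cont(2) by (intro borel_integrable_compact compact_cbox) (auto intro: continuous_on_subset)
  then have "integral (cbox c d) G' = (\<integral>z. indicator (cbox c d) z *\<^sub>R G' z \<partial>lborel)"
    using set_borel_integral_eq_integral(2)[of "cbox c d" G'] by (simp add: set_integrable_def set_lebesgue_integral_def)
  also have "(\<lambda>z. indicator (cbox c d) z *\<^sub>R G' z) = G'"
    by (rule ext) (auto simp: indicator_def of_bool_def supp')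
  finally show ?thesis using 0 by simp
qed

text \<open>
  Space-time points are functions on the independent variables.  On a time slice the spatial part is
  rewritten as an element of a Euclidean space, where integration takes place.
\<close>

definition point :: "real \<Rightarrow> real \<times> (real ^ 'n) \<Rightarrow> 'n indvar \<Rightarrow> real" where
  "point t w i = (case i of Vx \<Rightarrow> fst w | Vt \<Rightarrow> t | Vy j \<Rightarrow> snd w $ j)"

text \<open>
  Conservation of charge: differentiating under the integral sign, the time derivative of the charge is
  minus an integral of spatial derivatives of compactly supported functions.
\<close>

lemma conserved_integral:
  fixes G G' :: "('n::finite) indvar \<Rightarrow> ('n indvar \<Rightarrow> real) \<Rightarrow> real"
  assumes der: "\<And>i z s. ((\<lambda>s. G i (z(i := s))) has_field_derivative G' i (z(i := s))) (at s)"
    and cont: "\<And>i. continuous_on UNIV (G i)" "\<And>i. continuous_on UNIV (G' i)"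
    and div: "\<And>z. G' Vt z + G' Vx z + (\<Sum>j\<in>UNIV. G' (Vy j) z) = 0"
    and supp: "\<And>i z k. k \<noteq> Vt \<Longrightarrow> z k \<notin> {\<alpha>..\<beta>} \<Longrightarrow> G i z = 0"
    and final: "\<And>z. z Vt = 2 \<Longrightarrow> G Vt z = 0"
  shows "integral (cbox (\<alpha>, \<chi> j. \<alpha>) (\<beta>, \<chi> j. \<beta>)) (\<lambda>w. G Vt (point 0 w)) = 0"
proof -
  define B :: "(real \<times> (real ^ 'n)) set" where "B = cbox (\<alpha>, \<chi> j. \<alpha>) (\<beta>, \<chi> j. \<beta>)"
  have memB: "w \<in> B \<longleftrightarrow> fst w \<in> {\<alpha>..\<beta>} \<and> (\<forall>j. snd w $ j \<in> {\<alpha>..\<beta>})" for w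
    unfolding B_def by (cases w) (auto simp: cbox_Pair_eq mem_box_cart)
  have cont_point: "continuous_on UNIV (\<lambda>(t, w). point t w :: 'n indvar \<Rightarrow> real)"
  proof (intro continuous_on_coordinatewise_then_product)
    fix i :: "'n indvar"
    show "continuous_on UNIV (\<lambda>x. (case x of (t, w) \<Rightarrow> point t w) i)"
      by (cases i) (auto simp: point_def split_beta intro!: continuous_intros)
  qed
  have contB: "continuous_on A (\<lambda>w. F (point t w))"
    if "continuous_on UNIV F" for F :: "('n indvar \<Rightarrow> real) \<Rightarrow> real" and A t
  proof -
    have "continuous_on A (\<lambda>w. (\<lambda>(t, w). point t w :: 'n indvar \<Rightarrow> real) (t, w))"
      by (intro continuous_on_compose2[OF cont_point] continuous_intros) auto
    from continuous_on_compose2[OF that this] show ?thesis by simp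
  qed
  have space: "integral B (\<lambda>w. G' i (point t w)) = 0" if "i \<noteq> Vt" for i t
  proof -
    define e :: "real \<times> (real ^ 'n)" where
      "e = (case i of Vx \<Rightarrow> (1, 0) | Vt \<Rightarrow> 0 | Vy j \<Rightarrow> (0, axis j 1))"
    have shift: "point t (w + s *\<^sub>R e) = (point t w)(i := point t w i + s)" for w s
      using that by (cases i) (auto simp: point_def e_def fun_eq_iff axis_def split: indvar.splits)
    show ?thesis
      unfolding B_def
    proof (rule integral_directional_derivative_eq_0[where G = "\<lambda>w. G i (point t w)" and e = e])
      fix w s
      have "((\<lambda>s. point t w i + s) has_field_derivative 1) (at s)"
        by (auto intro!: derivative_eq_intros)
      from DERIV_chain2[OF der[of i "point t w"] this]
      show "((\<lambda>s. G i (point t (w + s *\<^sub>R e))) has_field_derivative G' i (point t (w + s *\<^sub>R e))) (at s)"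
        unfolding shift by simp
    next
      fix w :: "real \<times> (real ^ 'n)"
      assume "w \<notin> cbox (\<alpha>, \<chi> j. \<alpha>) (\<beta>, \<chi> j. \<beta>)"
      then have "w \<notin> B" by (simp add: B_def)
      then obtain k where "k \<noteq> Vt" "point t w k \<notin> {\<alpha>..\<beta>}"
        unfolding memB by (metis indvar.distinct(1) indvar.distinct(5) indvar.simps(8,10) point_def)
      then show "G i (point t w) = 0" by (rule supp)
    qed (auto intro: contB cont)
  qed
  have "integral B (\<lambda>w. G' Vt (point t w)) = 0" for t
  proof -
    have int: "(\<lambda>w. G' i (point t w)) integrable_on B" for i
      unfolding B_def by (intro integrable_continuous contB cont)
    have "G' Vt z = - (G' Vx z + (\<Sum>j\<in>UNIV. G' (Vy j) z))" for z
      using div[of z] by linarith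
    then have "integral B (\<lambda>w. G' Vt (point t w)) =
      integral B (\<lambda>w. - (G' Vx (point t w) + (\<Sum>j\<in>UNIV. G' (Vy j) (point t w))))"
      by simp
    also have "\<dots> = - integral B (\<lambda>w. G' Vx (point t w) + (\<Sum>j\<in>UNIV. G' (Vy j) (point t w)))"
      by (rule integral_neg)
    also have "integral B (\<lambda>w. G' Vx (point t w) + (\<Sum>j\<in>UNIV. G' (Vy j) (point t w))) =
        integral B (\<lambda>w. G' Vx (point t w)) + integral B (\<lambda>w. \<Sum>j\<in>UNIV. G' (Vy j) (point t w))"
      by (intro integral_add integrable_sum int) auto
    also have "integral B (\<lambda>w. \<Sum>j\<in>UNIV. G' (Vy j) (point t w)) =
        (\<Sum>j\<in>UNIV. integral B (\<lambda>w. G' (Vy j) (point t w)))"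
      by (intro integral_sum int) auto
    also have "- (integral B (\<lambda>w. G' Vx (point t w)) + \<dots>) = 0"
      by (simp add: space)
    finally show ?thesis .
  qed
  moreover have "((\<lambda>t. integral B (\<lambda>w. G Vt (point t w))) has_field_derivative
      integral B (\<lambda>w. G' Vt (point t w))) (at t within UNIV)" for t
    unfolding B_def
  proof (rule leibniz_rule_field_derivative)
    fix t and w :: "real \<times> (real ^ 'n)"
    have upd: "(point t w)(Vt := s) = point s w" for s :: real
      by (auto simp: point_def fun_eq_iff split: indvar.splits)
    show "((\<lambda>t. G Vt (point t w)) has_field_derivative G' Vt (point t w)) (at t within UNIV)"
      using der[of Vt "point t w" t] by (simp only: upd)
    show "(\<lambda>w. G Vt (point t w)) integrable_on cbox (\<alpha>, \<chi> j. \<alpha>) (\<beta>, \<chi> j. \<beta>)"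
      by (intro integrable_continuous contB cont)
    show "continuous_on (UNIV \<times> cbox (\<alpha>, \<chi> j. \<alpha>) (\<beta>, \<chi> j. \<beta>)) (\<lambda>(t, w). G' Vt (point t w))"
    proof (rule continuous_on_subset)
      have "continuous_on UNIV (\<lambda>x. G' Vt ((\<lambda>(t, w). point t w) x))"
        by (rule continuous_on_compose2[OF cont(2) cont_point]) simp
      then show "continuous_on UNIV (\<lambda>(t, w). G' Vt (point t w))"
        by (simp add: split_beta)
    qed simp
  qed auto
  ultimately have "((\<lambda>t. integral B (\<lambda>w. G Vt (point t w))) has_field_derivative 0) (at t)" for t
    by simp
  then have "integral B (\<lambda>w. G Vt (point 0 w)) = integral B (\<lambda>w. G Vt (point 2 w))"
    using DERIV_isconst_all[of "\<lambda>t. integral B (\<lambda>w. G Vt (point t w))" 0 2] by blast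
  also have "\<dots> = 0"
    by (simp add: final point_def)
  finally show ?thesis unfolding B_def .
qed

section \<open>Formal solutions of the equation\<close>

text \<open>
  The order of differentiation is irrelevant on \<open>jet_alg\<close>, so any listing of the multiset can be chosen.
\<close>

definition total_deriv_mset :: "'n indvar multiset \<Rightarrow> 'n jet_fun \<Rightarrow> 'n jet_fun" where
  "total_deriv_mset J F = fold total_deriv (SOME is. mset is = J) F"

definition fu_tt :: "(real \<Rightarrow> real) \<Rightarrow> 'n jet_fun" where
  "fu_tt f = total_deriv Vt (total_deriv Vt (\<lambda>p. f (p (U {#}))))"

text \<open>
  A bound for the order of \<open>t\<close>-differentiation in \<open>F\<close>.  It shows that the consequence of the equation
  that contains \<open>u\<^sub>J\<^sub>t\<^sub>t\<^sub>t\<close> involves otherwise only derivatives with fewer \<open>t\<close>.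
\<close>

definition t_order_le :: "nat \<Rightarrow> 'n jet_fun \<Rightarrow> bool" where
  "t_order_le m F \<longleftrightarrow> (\<forall>p q. (\<forall>k. p (Ind k) = q (Ind k)) \<longrightarrow>
     (\<forall>M. count M Vt \<le> m \<longrightarrow> p (U M) = q (U M)) \<longrightarrow> F p = F q)"

lemma t_order_le_total_deriv:
  assumes F: "differential_function F" and t: "t_order_le m F"
  shows "t_order_le (m + (if i = Vt then 1 else 0)) (total_deriv i F)"
  unfolding t_order_le_def
proof (intro allI impI)
  fix p q :: "'a jet"
  assume pq: "\<forall>k. p (Ind k) = q (Ind k)"
    "\<forall>M. count M Vt \<le> m + (if i = Vt then 1 else 0) \<longrightarrow> p (U M) = q (U M)"
  have "F (flow i p s) = F (flow i q s)" for s
    using t[unfolded t_order_le_def, rule_format, of "flow i p s" "flow i q s"] pq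
    by (auto simp: flow_def)
  then show "total_deriv i F p = total_deriv i F q"
    using has_derivative_flow[OF F, of i q] by (intro total_deriv_eqI[OF F]) simp
qed

lemma total_deriv_zero_section:
  assumes F: "differential_function F"
    and zero: "\<And>p. (\<forall>M. p (U M) = 0) \<Longrightarrow> F p = 0" and p: "\<forall>M. p (U M) = 0"
  shows "total_deriv i F p = 0"
proof -
  have "F (flow i p s) = 0" for s
    by (rule zero) (use p in \<open>simp add: flow_def\<close>)
  then show ?thesis
    by (intro total_deriv_eqI[OF F]) simp
qed

context
  fixes f :: "real \<Rightarrow> real"
  assumes f: "smooth_real f"
begin

lemma jet_alg_fu: "jet_alg f (\<lambda>p. f (p (U {#})))"
  using jet_alg.comp[of f 0] by simp

lemma jet_alg_fold:
  "jet_alg f F \<Longrightarrow> jet_alg f (fold total_deriv is F)"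
  by (induction "is" arbitrary: F) (auto intro: jet_alg_total_deriv[OF f])

lemma jet_alg_fu_tt: "jet_alg f (fu_tt f)"
  unfolding fu_tt_def by (intro jet_alg_total_deriv[OF f] jet_alg_fu)

lemma fold_total_deriv_mset:
  fixes F :: "'n jet_fun"
  assumes "jet_alg f F" "mset is = mset js"
  shows "fold total_deriv is F = fold total_deriv js F"
proof -
  \<comment> \<open>Reordering a fold needs operators that commute on all arguments, hence the identity outside of the algebra.\<close>
  define D where "D = (\<lambda>i (G :: 'n jet_fun). if jet_alg f G then total_deriv i G else G)"
  have D: "fold D is F = fold total_deriv is F" for "is" :: "'n indvar list"
    using assms(1)
  proof (induction "is" arbitrary: F)
    case (Cons i "is")
    then show ?case
      using Cons.IH[OF jet_alg_total_deriv[OF f Cons.prems]] by (simp add: D_def)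
  qed simp
  have "D i \<circ> D j = D j \<circ> D i" for i j :: "'n indvar"
    using total_deriv_commute[OF f] jet_alg_total_deriv[OF f] by (fastforce simp: D_def fun_eq_iff)
  then have "fold D is = fold D js"
    by (intro fold_multiset_equiv assms(2))
  then show ?thesis using D by metis
qed

lemma total_deriv_mset_eq_fold: "jet_alg f F \<Longrightarrow> total_deriv_mset (mset is) F = fold total_deriv is F"
  unfolding total_deriv_mset_def by (intro fold_total_deriv_mset) (auto intro: someI)

lemma total_deriv_mset_empty: "jet_alg f F \<Longrightarrow> total_deriv_mset {#} F = F"
  using total_deriv_mset_eq_fold[of F "[]"] by simp

lemma total_deriv_mset_add_mset:
  assumes "jet_alg f F"
  shows "total_deriv_mset (add_mset i J) F = total_deriv i (total_deriv_mset J F)"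
proof -
  obtain "is" where "mset is = J" using ex_mset by blast
  then show ?thesis
    using total_deriv_mset_eq_fold[OF assms, of "is @ [i]"] total_deriv_mset_eq_fold[OF assms, of "is"] by simp
qed

lemma jet_alg_total_deriv_mset: "jet_alg f F \<Longrightarrow> jet_alg f (total_deriv_mset J F)"
  unfolding total_deriv_mset_def by (rule jet_alg_fold)

lemma t_order_le_total_deriv_mset:
  assumes "jet_alg f F" "t_order_le m F"
  shows "t_order_le (m + count J Vt) (total_deriv_mset J F)"
proof (induction J)
  case (add i J)
  from t_order_le_total_deriv[OF jet_alg_smooth[OF f jet_alg_total_deriv_mset[OF assms(1)]] this, of i]
  show ?case by (auto simp: total_deriv_mset_add_mset[OF assms(1)] split: if_splits)
qed (simp add: total_deriv_mset_empty assms)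

lemma t_order_le_total_deriv_mset_fu_tt: "t_order_le (count J Vt + 2) (total_deriv_mset J (fu_tt f))"
proof -
  have "t_order_le 0 (\<lambda>p. f (p (U {#})))"
    by (auto simp: t_order_le_def)
  from t_order_le_total_deriv[OF jet_alg_smooth[OF f jet_alg_fu] this, of Vt]
  have "t_order_le 1 (total_deriv Vt (\<lambda>p. f (p (U {#}))))" by simp
  from t_order_le_total_deriv[OF jet_alg_smooth[OF f jet_alg_total_deriv[OF f jet_alg_fu]] this, of Vt]
  have "t_order_le 2 (fu_tt f)" by (simp add: fu_tt_def numeral_2_eq_2)
  from t_order_le_total_deriv_mset[OF jet_alg_fu_tt this] show ?thesis by (simp add: add.commute)
qed

lemma total_deriv_fu: "total_deriv i (\<lambda>p. f (p (U {#}))) = (\<lambda>p. deriv f (p (U {#})) * p (U {#i#}))"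
  using total_deriv_comp[OF f, of i 0] by simp

text \<open>
  The zero function solves the equation, and the curve \<open>flow\<close> through the jet of the zero function
  stays among such jets.
\<close>

lemma total_deriv_mset_fu_tt_zero:
  assumes "\<forall>M. p (U M) = 0"
  shows "total_deriv_mset J (fu_tt f) p = 0"
  using assms
proof (induction J arbitrary: p)
  case empty
  show ?case
    unfolding total_deriv_mset_empty[OF jet_alg_fu_tt] unfolding fu_tt_def
    by (rule total_deriv_zero_section[OF jet_alg_smooth[OF f jet_alg_total_deriv[OF f jet_alg_fu]]])
      (simp_all add: total_deriv_fu empty)
next
  case (add i J)
  show ?case
    unfolding total_deriv_mset_add_mset[OF jet_alg_fu_tt]
    by (rule total_deriv_zero_section[OF jet_alg_smooth[OF f jet_alg_total_deriv_mset[OF jet_alg_fu_tt]]])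
      (simp_all add: add)
qed

lemma fold_total_deriv_pde:
  fixes "is" :: "('n::finite) indvar list"
  shows "fold total_deriv is (pde_lhs f a b) = (\<lambda>p. p (U (mset is + {#Vt, Vx#}))
    + total_deriv_mset (mset is) (fu_tt f) p + a * p (U (mset is + {#Vt, Vt, Vt#}))
    + b * (\<Sum>j\<in>UNIV. p (U (mset is + {#Vy j, Vy j#}))))"
proof (induction "is" rule: rev_induct)
  case Nil
  show ?case
    unfolding pde_lhs_def by (simp add: total_deriv_mset_empty[OF jet_alg_fu_tt] fun_eq_iff) (simp add: fu_tt_def)
next
  case (snoc i "is")
  have "total_deriv i (\<lambda>p. p (U (J + K)) + total_deriv_mset J (fu_tt f) p + a * p (U (J + L))
      + b * (\<Sum>j\<in>UNIV. p (U (J + N j)))) =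
    (\<lambda>p. p (U (add_mset i J + K)) + total_deriv_mset (add_mset i J) (fu_tt f) p + a * p (U (add_mset i J + L))
      + b * (\<Sum>j\<in>UNIV. p (U (add_mset i J + N j))))" for J K L and N :: "'n \<Rightarrow> 'n indvar multiset"
    by (simp add: total_deriv_mset_add_mset[OF jet_alg_fu_tt] total_deriv_add[OF f]
        total_deriv_cmult[OF f] total_deriv_sum[OF f] total_deriv_coord[OF f]
        jet_alg.intros jet_alg_sum jet_alg_total_deriv_mset jet_alg_fu_tt)
  moreover have "fold total_deriv (is @ [i]) (pde_lhs f a b) = total_deriv i (fold total_deriv is (pde_lhs f a b))"
    "mset (is @ [i]) = add_mset i (mset is)"
    by simp_all
  ultimately show ?case
    using snoc by presburger
qed

end

text \<open>
  One round of solving the differential consequences for the derivatives \<open>u\<^sub>J\<^sub>t\<^sub>t\<^sub>t\<close>, with the right-hand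
  side evaluated at the given jet.  For \<open>a \<noteq> 0\<close> a jet satisfies the equation and all its
  consequences iff it is a fixed point.
\<close>

definition solve_step :: "(real \<Rightarrow> real) \<Rightarrow> real \<Rightarrow> real \<Rightarrow> ('n::finite) jet \<Rightarrow> 'n jet" where
  "solve_step f a b p c = (case c of Ind k \<Rightarrow> p c | U M \<Rightarrow>
     if count M Vt < 3 then p c
     else let J = M - {#Vt, Vt, Vt#} in
       - (p (U (J + {#Vt, Vx#})) + total_deriv_mset J (fu_tt f) p
          + b * (\<Sum>j\<in>UNIV. p (U (J + {#Vy j, Vy j#})))) / a)"

text \<open>
  The iteration is stationary at a derivative after as many rounds as it contains \<open>t\<close>, because each
  round uses only derivatives with fewer \<open>t\<close>.  The derivatives with at most two \<open>t\<close> are the free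
  Cauchy data.
\<close>

definition solution_jet :: "(real \<Rightarrow> real) \<Rightarrow> real \<Rightarrow> real \<Rightarrow> ('n::finite) jet \<Rightarrow> 'n jet" where
  "solution_jet f a b p c = (case c of Ind k \<Rightarrow> p c | U M \<Rightarrow> (solve_step f a b ^^ count M Vt) p c)"

context
  fixes f :: "real \<Rightarrow> real" and a b :: real
  assumes f: "smooth_real f"
begin

abbreviation "step \<equiv> solve_step f a b"

lemma solve_step_principal:
  "step p (U (J + {#Vt, Vt, Vt#})) = - (p (U (J + {#Vt, Vx#})) + total_deriv_mset J (fu_tt f) p
     + b * (\<Sum>j\<in>UNIV. p (U (J + {#Vy j, Vy j#})))) / a"
  by (simp add: solve_step_def Let_def)

lemma funpow_step_Ind: "(step ^^ n) p (Ind k) = p (Ind k)"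
  by (induction n) (simp_all add: solve_step_def)

lemma solve_step_cong:
  assumes "\<And>k. p (Ind k) = q (Ind k)"
    and "\<And>M'. count M' Vt < count M Vt \<Longrightarrow> p (U M') = q (U M')"
    and "count M Vt < 3 \<Longrightarrow> p (U M) = q (U M)"
  shows "step p (U M) = step q (U M)"
proof (cases "count M Vt < 3")
  case False
  have "total_deriv_mset (M - {#Vt, Vt, Vt#}) (fu_tt f) p = total_deriv_mset (M - {#Vt, Vt, Vt#}) (fu_tt f) q"
    using t_order_le_total_deriv_mset_fu_tt[OF f, of "M - {#Vt, Vt, Vt#}"] assms(1,2) False
    unfolding t_order_le_def by simp
  then show ?thesis
    using False assms(2) by (simp add: solve_step_def Let_def)
qed (simp add: solve_step_def assms)

lemma funpow_step_stable:
  "count M Vt \<le> n \<Longrightarrow> (step ^^ Suc n) p (U M) = (step ^^ n) p (U M)"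
proof (induction n arbitrary: M)
  case 0
  then show ?case by (simp add: solve_step_def)
next
  case (Suc n)
  show ?case
  proof (cases "count M Vt < 3")
    case True
    then show ?thesis by (simp add: solve_step_def)
  next
    case False
    then have "step ((step ^^ Suc n) p) (U M) = step ((step ^^ n) p) (U M)"
      using Suc by (intro solve_step_cong) (auto simp: funpow_step_Ind simp del: funpow.simps)
    then show ?thesis by simp
  qed
qed

lemma funpow_step_solution:
  assumes "count M Vt \<le> n"
  shows "(step ^^ n) p (U M) = solution_jet f a b p (U M)"
  using assms
proof (induction rule: dec_induct)
  case (step n)
  then show ?case by (simp add: funpow_step_stable[simplified])
qed (simp add: solution_jet_def)

lemma solve_step_solution: "step (solution_jet f a b p) = solution_jet f a b p"
proof
  fix c show "step (solution_jet f a b p) c = solution_jet f a b p c"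
  proof (cases c)
    case (U M)
    have "step (solution_jet f a b p) (U M) = step ((step ^^ count M Vt) p) (U M)"
      by (rule solve_step_cong) (simp_all add: funpow_step_solution, simp add: solution_jet_def funpow_step_Ind)
    also have "\<dots> = solution_jet f a b p (U M)"
      using funpow_step_stable[of M "count M Vt" p] by (simp add: solution_jet_def)
    finally show ?thesis by (simp add: U)
  qed (simp add: solve_step_def)
qed

lemma solution_jet_in_equation:
  fixes p :: "('n::finite) jet"
  assumes "a \<noteq> 0"
  shows "solution_jet f a b p \<in> equation_jets (pde_lhs f a b)"
  unfolding equation_jets_def mem_Collect_eq
proof
  fix "is" :: "'n indvar list"
  let ?q = "solution_jet f a b p" and ?J = "mset is"
  have "?q (U (?J + {#Vt, Vt, Vt#})) = step ?q (U (?J + {#Vt, Vt, Vt#}))"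
    by (simp add: solve_step_solution)
  also have "\<dots> = - (?q (U (?J + {#Vt, Vx#})) + total_deriv_mset ?J (fu_tt f) ?q
          + b * (\<Sum>j\<in>UNIV. ?q (U (?J + {#Vy j, Vy j#})))) / a"
    by (simp add: solve_step_def Let_def)
  finally show "fold total_deriv is (pde_lhs f a b) ?q = 0"
    unfolding fold_total_deriv_pde[OF f] using assms by simp
qed

text \<open>
  Differentiating the formula for \<open>u\<^sub>J\<^sub>t\<^sub>t\<^sub>t\<close> in a spatial direction \<open>i\<close> yields the formula for
  \<open>u\<^sub>J\<^sub>i\<^sub>t\<^sub>t\<^sub>t\<close>.  Hence solving pointwise turns the jets of smooth Cauchy data along the slice into
  a family of jets that is again compatible with spatial differentiation.
\<close>

lemma solve_step_prolongs:
  assumes \<gamma>: "prolongs i \<gamma> s" and i: "i \<noteq> Vt"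
  shows "prolongs i (\<lambda>s. step (\<gamma> s)) s"
  unfolding prolongs_def
proof (intro conjI allI)
  show "((\<lambda>s. step (\<gamma> s) (Ind k)) has_field_derivative (if k = i then 1 else 0)) (at s)" for k
    using \<gamma> by (simp add: solve_step_def prolongs_def)
  have coord: "((\<lambda>s. \<gamma> s (U M)) has_field_derivative \<gamma> s (U (add_mset i M))) (at s)" for M
    using \<gamma> by (simp add: prolongs_def)
  fix M
  show "((\<lambda>s. step (\<gamma> s) (U M)) has_field_derivative step (\<gamma> s) (U (add_mset i M))) (at s)"
  proof (cases "count M Vt < 3")
    case True
    then show ?thesis using i coord by (simp add: solve_step_def)
  next
    case False
    define J where "J = M - {#Vt, Vt, Vt#}"
    have J: "M = J + {#Vt, Vt, Vt#}"
      using False by (intro multiset_eqI) (auto simp: J_def)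
    have "((\<lambda>s. total_deriv_mset J (fu_tt f) (\<gamma> s)) has_field_derivative
        total_deriv_mset (add_mset i J) (fu_tt f) (\<gamma> s)) (at s)"
      using total_deriv_prolongs[OF jet_alg_smooth[OF f jet_alg_total_deriv_mset[OF f jet_alg_fu_tt[OF f]]] \<gamma>, of J]
      by (simp add: total_deriv_mset_add_mset[OF f jet_alg_fu_tt[OF f]])
    moreover have "((\<lambda>s. \<gamma> s (U (J + K))) has_field_derivative \<gamma> s (U (add_mset i J + K))) (at s)" for K
      using coord[of "J + K"] by simp
    ultimately have "((\<lambda>s. - (\<gamma> s (U (J + {#Vt, Vx#})) + total_deriv_mset J (fu_tt f) (\<gamma> s)
          + b * (\<Sum>j\<in>UNIV. \<gamma> s (U (J + {#Vy j, Vy j#})))) / a) has_field_derivative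
       - (\<gamma> s (U (add_mset i J + {#Vt, Vx#})) + total_deriv_mset (add_mset i J) (fu_tt f) (\<gamma> s)
          + b * (\<Sum>j\<in>UNIV. \<gamma> s (U (add_mset i J + {#Vy j, Vy j#})))) / a) (at s)"
      by (intro DERIV_cdivide DERIV_minus DERIV_add DERIV_cmult DERIV_sum)
    moreover have "step (\<gamma> s) (U M) = - (\<gamma> s (U (J + {#Vt, Vx#})) + total_deriv_mset J (fu_tt f) (\<gamma> s)
          + b * (\<Sum>j\<in>UNIV. \<gamma> s (U (J + {#Vy j, Vy j#})))) / a" for s
      unfolding J by (rule solve_step_principal)
    moreover have "step (\<gamma> s) (U (add_mset i M)) = - (\<gamma> s (U (add_mset i J + {#Vt, Vx#}))
          + total_deriv_mset (add_mset i J) (fu_tt f) (\<gamma> s)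
          + b * (\<Sum>j\<in>UNIV. \<gamma> s (U (add_mset i J + {#Vy j, Vy j#})))) / a"
      using solve_step_principal[of "\<gamma> s" "add_mset i J"] by (simp only: J union_mset_add_mset_left)
    ultimately show ?thesis by presburger
  qed
qed

lemma solution_jet_prolongs:
  assumes \<gamma>: "prolongs i \<gamma> s" and i: "i \<noteq> Vt"
  shows "prolongs i (\<lambda>s. solution_jet f a b (\<gamma> s)) s"
proof -
  have "prolongs i (\<lambda>s. (step ^^ n) (\<gamma> s)) s" for n
    by (induction n) (simp_all add: \<gamma> solve_step_prolongs i)
  then show ?thesis
    using \<gamma> i unfolding prolongs_def solution_jet_def by simp
qed

lemma solution_jet_continuous:
  fixes p :: "'a::topological_space \<Rightarrow> ('n::finite) jet"
  assumes p: "\<And>c. continuous_on A (\<lambda>z. p z c)"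
  shows "continuous_on A (\<lambda>z. solution_jet f a b (p z) c)"
proof -
  have step_cont: "continuous_on A (\<lambda>z. step (q z) c)"
    if q: "\<And>c. continuous_on A (\<lambda>z. q z c)" for q :: "'a \<Rightarrow> 'n jet" and c
  proof -
    have contq: "continuous_on A q"
      by (intro continuous_on_coordinatewise_then_product q)
    have cont: "continuous_on UNIV (total_deriv_mset J (fu_tt f) :: 'n jet_fun)" for J
      using jet_alg_C1[OF f jet_alg_total_deriv_mset[OF f jet_alg_fu_tt[OF f]]] by blast
    have R: "continuous_on A (\<lambda>z. total_deriv_mset J (fu_tt f) (q z))" for J
      by (rule continuous_on_compose2[OF cont contq]) simp
    have principal: "continuous_on A (\<lambda>z. - (q z (U K) + total_deriv_mset J (fu_tt f) (q z)
        + b * (\<Sum>j\<in>UNIV. q z (U (N j)))) * inverse a)" for J K and N :: "'n \<Rightarrow> 'n indvar multiset"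
      by (intro continuous_intros q R)
    show ?thesis
    proof (cases c)
      case (U M)
      then show ?thesis
        using q principal by (cases "count M Vt < 3") (simp_all add: solve_step_def Let_def divide_inverse)
    qed (simp add: solve_step_def q)
  qed
  have "continuous_on A (\<lambda>z. (step ^^ n) (p z) c)" for n c
    by (induction n arbitrary: c) (simp_all add: p step_cont)
  then show ?thesis
    using p by (cases c) (simp_all add: solution_jet_def)
qed

lemma solution_jet_zero:
  assumes p: "\<forall>M. p (U M) = 0"
  shows "solution_jet f a b p (U M) = 0"
proof -
  have "step q (U M) = 0" if "\<forall>M. q (U M) = 0" for q :: "'a jet" and M
    using that total_deriv_mset_fu_tt_zero[OF f that] by (simp add: solve_step_def Let_def)
  then have "\<forall>M. (step ^^ n) p (U M) = 0" for n
    by (induction n) (simp_all add: p)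
  then show ?thesis by (simp add: solution_jet_def)
qed

lemma solution_jet_param:
  assumes M: "count M Vt < 3"
  shows "solution_jet f a b p (U M) = p (U M)"
proof -
  have "(step ^^ n) p (U M) = p (U M)" for n
    by (induction n) (use M in \<open>simp_all add: solve_step_def\<close>)
  then show ?thesis by (simp add: solution_jet_def)
qed

end

section \<open>Initial data and their extension in time\<close>

text \<open>
  Cauchy data \<open>u = u\<^sub>t = 0\<close>, \<open>u\<^sub>t\<^sub>t = B(x) \<Prod>\<^sub>j B(y\<^sub>j)\<close>, with all spatial derivatives.  The entries with more
  than two \<open>t\<close> are overwritten by \<open>solution_jet\<close>; the value \<open>0\<close> keeps them compatible with spatial
  differentiation.
\<close>

definition bump_data :: "(real \<Rightarrow> real) \<Rightarrow> (('n::finite) indvar \<Rightarrow> real) \<Rightarrow> 'n jet" where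
  "bump_data B z c = (case c of Ind k \<Rightarrow> z k | U M \<Rightarrow>
     if count M Vt = 2
     then (deriv ^^ count M Vx) B (z Vx) * (\<Prod>j\<in>UNIV. (deriv ^^ count M (Vy j)) B (z (Vy j)))
     else 0)"

lemma bump_data_prolongs:
  fixes z :: "('n::finite) indvar \<Rightarrow> real"
  assumes B: "smooth_real B" and i: "i \<noteq> Vt"
  shows "prolongs i (\<lambda>s. bump_data B (z(i := s))) s"
  unfolding prolongs_def
proof (intro conjI allI)
  fix k
  show "((\<lambda>s. bump_data B (z(i := s)) (Ind k)) has_field_derivative (if k = i then 1 else 0)) (at s)"
    by (cases "k = i") (auto simp: bump_data_def)
next
  fix M :: "'n indvar multiset"
  let ?d = "\<lambda>k. (deriv ^^ count M k) B"
  show "((\<lambda>s. bump_data B (z(i := s)) (U M)) has_field_derivative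
      bump_data B (z(i := s)) (U (add_mset i M))) (at s)"
  proof (cases i)
    case Vx
    then show ?thesis
      using DERIV_mult[OF smooth_real_deriv[OF B, of "count M Vx" s]
          DERIV_const[of "\<Prod>j\<in>UNIV. ?d (Vy j) (z (Vy j))"]]
      by (simp add: bump_data_def)
  next
    case (Vy l)
    have 1: "(\<Prod>j\<in>UNIV. ?d (Vy j) ((z(i := s)) (Vy j))) = ?d (Vy l) s * (\<Prod>j\<in>UNIV - {l}. ?d (Vy j) (z (Vy j)))" for s
      by (subst prod.remove[of _ l]) (auto simp: Vy intro!: prod.cong)
    have 2: "(\<Prod>j\<in>UNIV. (deriv ^^ count (add_mset i M) (Vy j)) B ((z(i := s)) (Vy j))) =
        (deriv ^^ Suc (count M (Vy l))) B s * (\<Prod>j\<in>UNIV - {l}. ?d (Vy j) (z (Vy j)))" for s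
      by (subst prod.remove[of _ l]) (auto simp: Vy intro!: prod.cong)
    have "((\<lambda>s. ?d Vx (z Vx) * (?d (Vy l) s * (\<Prod>j\<in>UNIV - {l}. ?d (Vy j) (z (Vy j))))) has_field_derivative
       ?d Vx (z Vx) * ((deriv ^^ Suc (count M (Vy l))) B s * (\<Prod>j\<in>UNIV - {l}. ?d (Vy j) (z (Vy j))))) (at s)"
      by (intro DERIV_cmult DERIV_cmult_right smooth_real_deriv B)
    then show ?thesis
      unfolding bump_data_def coord.case 1 2 by (simp add: Vy)
  qed (use i in simp)
qed

lemma bump_data_continuous:
  fixes B :: "real \<Rightarrow> real"
  assumes B: "smooth_real B"
  shows "continuous_on UNIV (\<lambda>z :: ('n::finite) indvar \<Rightarrow> real. bump_data B z c)"
proof -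
  have d: "continuous_on UNIV (\<lambda>z :: 'n indvar \<Rightarrow> real. (deriv ^^ k) B (z i))" for k i
  proof -
    have "continuous_on UNIV ((deriv ^^ k) B)"
      using smooth_real_deriv[OF B, of k] by (metis DERIV_isCont continuous_at_imp_continuous_on)
    from continuous_on_compose2[OF this continuous_on_product_coordinates[of i]]
    show ?thesis by simp
  qed
  show ?thesis
  proof (cases c)
    case (U M)
    have "continuous_on UNIV (\<lambda>z :: 'n indvar \<Rightarrow> real. (deriv ^^ count M Vx) B (z Vx) *
        (\<Prod>j\<in>UNIV. (deriv ^^ count M (Vy j)) B (z (Vy j))))"
      by (intro continuous_intros d)
    then show ?thesis
      by (cases "count M Vt = 2") (simp_all add: bump_data_def U)
  qed (simp add: bump_data_def)
qed

text \<open>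
  The jets of \<open>\<Sum>\<^sub>j g\<^sub>j(t) u\<^sub>j(x, y)\<close>, where \<open>u\<^sub>j\<close> is the \<open>j\<close>-th \<open>t\<close>-derivative on the slice.  If the
  functions \<open>g\<^sub>j\<close> behave like \<open>t\<^sup>j/j!\<close> up to order \<open>m\<close> at \<open>0\<close>, the \<open>t\<close>-derivatives up to
  that order are the given ones at \<open>t = 0\<close>.
\<close>

definition time_extension ::
  "nat \<Rightarrow> (nat \<Rightarrow> real \<Rightarrow> real) \<Rightarrow> (('n indvar \<Rightarrow> real) \<Rightarrow> 'n jet) \<Rightarrow> ('n indvar \<Rightarrow> real) \<Rightarrow> 'n jet" where
  "time_extension m g w z c = (case c of Ind k \<Rightarrow> z k | U M \<Rightarrow>
     \<Sum>j\<le>m. (deriv ^^ count M Vt) (g j) (z Vt) *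
       w (z(Vt := 0)) (U (filter_mset (\<lambda>i. i \<noteq> Vt) M + replicate_mset j Vt)))"

lemma time_extension_prolongs:
  assumes g: "\<And>j. smooth_real (g j)"
    and w: "\<And>i z s. i \<noteq> Vt \<Longrightarrow> prolongs i (\<lambda>s. w (z(i := s))) s"
  shows "prolongs i (\<lambda>s. time_extension m g w (z(i := s))) s"
  unfolding prolongs_def
proof (intro conjI allI)
  fix k
  show "((\<lambda>s. time_extension m g w (z(i := s)) (Ind k)) has_field_derivative (if k = i then 1 else 0)) (at s)"
    by (cases "k = i") (auto simp: time_extension_def)
next
  fix M
  let ?N = "\<lambda>M j. filter_mset (\<lambda>i. i \<noteq> Vt) M + replicate_mset j Vt"
  show "((\<lambda>s. time_extension m g w (z(i := s)) (U M)) has_field_derivative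
      time_extension m g w (z(i := s)) (U (add_mset i M))) (at s)"
  proof (cases "i = Vt")
    case True
    have "((\<lambda>s. \<Sum>j\<le>m. (deriv ^^ count M Vt) (g j) s * w (z(Vt := 0)) (U (?N M j))) has_field_derivative
       (\<Sum>j\<le>m. (deriv ^^ Suc (count M Vt)) (g j) s * w (z(Vt := 0)) (U (?N M j)))) (at s)"
      by (intro DERIV_sum DERIV_cmult_right smooth_real_deriv g)
    then show ?thesis
      unfolding time_extension_def True coord.case by simp
  next
    case False
    have "((\<lambda>s. w ((z(Vt := 0))(i := s)) (U (?N M j))) has_field_derivative
        w ((z(Vt := 0))(i := s)) (U (add_mset i (?N M j)))) (at s)" for j
      using w[OF False] unfolding prolongs_def by blast
    then have "((\<lambda>s. \<Sum>j\<le>m. (deriv ^^ count M Vt) (g j) (z Vt) * w ((z(Vt := 0))(i := s)) (U (?N M j))) has_field_derivative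
       (\<Sum>j\<le>m. (deriv ^^ count M Vt) (g j) (z Vt) * w ((z(Vt := 0))(i := s)) (U (add_mset i (?N M j))))) (at s)"
      by (intro DERIV_sum DERIV_cmult)
    moreover have twist: "(z(i := s))(Vt := 0) = (z(Vt := 0))(i := s)" for s
      using False by (rule fun_upd_twist)
    moreover have "(z(i := s)) Vt = z Vt" for s
      using False by simp
    moreover have "?N (add_mset i M) j = add_mset i (?N M j)" "count (add_mset i M) Vt = count M Vt" for j
      using False by simp_all
    ultimately show ?thesis
      unfolding time_extension_def coord.case by (simp only:)
  qed
qed

lemma time_extension_continuous:
  assumes g: "\<And>j. smooth_real (g j)"
    and w: "\<And>c. continuous_on UNIV (\<lambda>z. w z c)"
  shows "continuous_on UNIV (\<lambda>z. time_extension m g w z c)"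
proof -
  have d: "continuous_on UNIV (\<lambda>z :: 'n indvar \<Rightarrow> real. (deriv ^^ k) (g j) (z Vt))" for k j
  proof -
    have "continuous_on UNIV ((deriv ^^ k) (g j))"
      using smooth_real_deriv[OF g[of j], of k] by (metis DERIV_isCont continuous_at_imp_continuous_on)
    from continuous_on_compose2[OF this continuous_on_product_coordinates[of Vt]]
    show ?thesis by simp
  qed
  have "continuous_on UNIV (\<lambda>z :: 'n indvar \<Rightarrow> real. z(Vt := 0))"
  proof (intro continuous_on_coordinatewise_then_product)
    fix k show "continuous_on UNIV (\<lambda>z :: 'n indvar \<Rightarrow> real. (z(Vt := 0)) k)"
      by (cases "k = Vt") auto
  qed
  from continuous_on_compose2[OF w this]
  have "continuous_on UNIV (\<lambda>z. w (z(Vt := 0)) c)" for c by simp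
  then show ?thesis
    by (cases c) (auto simp: time_extension_def intro!: continuous_intros d)
qed

lemma time_extension_initial:
  assumes g: "\<And>j k. j \<le> m \<Longrightarrow> k \<le> m \<Longrightarrow> (deriv ^^ k) (g j) 0 = (if k = j then 1 else 0)"
    and M: "count M Vt \<le> m" and z: "z Vt = 0"
  shows "time_extension m g w z (U M) = w z (U M)"
proof -
  have "z(Vt := 0) = z" using z by auto
  then have "time_extension m g w z (U M) =
      (\<Sum>j\<le>m. if j = count M Vt then w z (U (filter_mset (\<lambda>i. i \<noteq> Vt) M + replicate_mset j Vt)) else 0)"
    unfolding time_extension_def coord.case using g M z by (intro sum.cong) auto
  also have "\<dots> = w z (U (filter_mset (\<lambda>i. i \<noteq> Vt) M + replicate_mset (count M Vt) Vt))"
    using M by simp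
  also have "filter_mset (\<lambda>i. i \<noteq> Vt) M + replicate_mset (count M Vt) Vt = M"
    by (intro multiset_eqI) auto
  finally show ?thesis .
qed

section \<open>Conservation laws with multipliers depending on x\<close>

text \<open>
  The density and fluxes of \<open>h(x) E\<close>.
\<close>

definition multiplier_law :: "(real \<Rightarrow> real) \<Rightarrow> real \<Rightarrow> real \<Rightarrow> (real \<Rightarrow> real) \<Rightarrow> ('n::finite) jet_tuple" where
  "multiplier_law f a b h i p = (case i of
      Vt \<Rightarrow> h (p (Ind Vx)) * (p (U {#Vx#}) + deriv f (p (U {#})) * p (U {#Vt#}) + a * p (U {#Vt, Vt#}))
    | Vx \<Rightarrow> 0
    | Vy j \<Rightarrow> b * h (p (Ind Vx)) * p (U {#Vy j#}))"

text \<open>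
  The argument by charges: the density of the divergence-free part has the same integral over every
  time slice, and this integral is computed at \<open>t = 0\<close>, where it is \<open>\<integral> a h \<phi>\<close>, and at \<open>t = 2\<close>, where it
  is zero.
\<close>

lemma trivial_multiplier_law_imp_zero:
  fixes f h :: "real \<Rightarrow> real"
  assumes f: "smooth_real f" and a: "a \<noteq> 0" and h: "continuous_on UNIV h"
    and triv: "trivial_tuple (pde_lhs f a b) (multiplier_law f a b h :: ('n::finite) jet_tuple)"
  shows "h x0 = 0"
proof (rule ccontr)
  assume h0: "h x0 \<noteq> 0"
  obtain P Q :: "'n jet_tuple" where P: "\<And>i. differential_function (P i)"
    and Q: "\<And>i. differential_function (Q i)"
    and PQ: "\<And>i p. multiplier_law f a b h i p = P i p + Q i p"
    and P0: "\<And>i p. p \<in> equation_jets (pde_lhs f a b) \<Longrightarrow> P i p = 0"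
    and div: "\<And>p. total_divergence Q p = 0"
    using triv unfolding trivial_tuple_def vanishes_modulo_def by blast
  \<comment> \<open>The sign \<open>\<sigma>\<close> makes the integrand nonnegative; the bump lives where \<open>\<sigma> a h\<close> is positive.\<close>
  define \<sigma> where "\<sigma> = sgn (h x0 * a)"
  have "\<sigma> * (h x0 * a) > 0"
    using h0 a by (auto simp: \<sigma>_def sgn_if mult_less_0_iff zero_less_mult_iff)
  moreover have "open {x. \<sigma> * (h x * a) > 0}"
    by (intro open_Collect_less continuous_intros h)
  ultimately obtain e where e: "e > 0" "ball x0 e \<subseteq> {x. \<sigma> * (h x * a) > 0}"
    unfolding open_contains_ball by blast
  define \<alpha> \<beta> where "\<alpha> = x0 - e" and "\<beta> = x0 + e"
  have pos: "\<sigma> * (h x * a) > 0" if "\<alpha> < x" "x < \<beta>" for x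
  proof -
    have "x \<in> ball x0 e"
      using that by (simp add: \<alpha>_def \<beta>_def dist_real_def abs_if)
    then show ?thesis using e(2) by blast
  qed
  obtain B where B: "smooth_real B" "\<And>x. \<alpha> < x \<Longrightarrow> x < \<beta> \<Longrightarrow> B x > 0"
    "\<And>x. x \<notin> {\<alpha><..<\<beta>} \<Longrightarrow> B x = 0"
    using bump_function[of \<alpha> \<beta>] by blast
  have B_outside: "(deriv ^^ k) B x = 0" if "x \<notin> {\<alpha>..\<beta>}" for k x
  proof (rule iterated_deriv_eq_0[of "- {\<alpha>..\<beta>}"])
    show "B x = 0" if "x \<in> - {\<alpha>..\<beta>}" for x
      by (rule B(3)) (use that in auto)
  qed (use that in \<open>simp_all add: open_Compl\<close>)

  define W :: "('n indvar \<Rightarrow> real) \<Rightarrow> 'n jet"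
    where "W = (\<lambda>z. solution_jet f a b (bump_data B z))"
  have W_prolongs: "prolongs i (\<lambda>s. W (z(i := s))) s" if "i \<noteq> Vt" for i z s
    unfolding W_def by (intro solution_jet_prolongs f bump_data_prolongs B that)
  have W_cont: "continuous_on UNIV (\<lambda>z. W z c)" for c
    unfolding W_def by (intro solution_jet_continuous f bump_data_continuous B)
  have W_Ind: "W z (Ind k) = z k" for z k
    by (simp add: W_def solution_jet_def bump_data_def)
  have W_outside: "W z (U M) = 0" if "k \<noteq> Vt" "z k \<notin> {\<alpha>..\<beta>}" for z k M
  proof -
    have "(deriv ^^ n) B (z k) = 0" for n
      by (rule B_outside[OF that(2)])
    then have "bump_data B z (U N) = 0" for N
      using that(1) by (cases k) (simp_all add: bump_data_def prod_zero_iff, blast)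
    then show ?thesis
      unfolding W_def using solution_jet_zero[OF f] by blast
  qed

  obtain S where S: "finite S" "\<And>p q. (\<forall>c\<in>S. p c = q c) \<Longrightarrow> P Vt p = P Vt q"
    using differential_functionE[OF P[of Vt]] by metis
  have "finite ((\<lambda>M. count M Vt) ` {M. U M \<in> S})"
    by (intro finite_imageI finite_jet_indices S)
  then obtain m' where m': "\<And>M. U M \<in> S \<Longrightarrow> count M Vt \<le> m'"
    unfolding finite_nat_set_iff_bounded_le by blast
  \<comment> \<open>The extension has to agree with the formal solution in all coordinates seen by \<open>P\<close> and by the density, which involves \<open>u\<^sub>t\<^sub>t\<close>.\<close>
  define m where "m = max m' 2"
  have m: "2 \<le> m" "\<And>M. U M \<in> S \<Longrightarrow> count M Vt \<le> m"
    using m' by (force simp: m_def)+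
  have "\<exists>g. smooth_real g \<and> (\<forall>t>1. g t = 0) \<and> (\<forall>k\<le>m. (deriv ^^ k) g 0 = (if k = j then 1 else 0))" for j
    by (rule prescribed_jet)
  then obtain g where g: "\<And>j. smooth_real (g j)" "\<And>j t. t > 1 \<Longrightarrow> g j t = 0"
    "\<And>j k. k \<le> m \<Longrightarrow> (deriv ^^ k) (g j) 0 = (if k = j then 1 else 0)"
    by metis
  define V where "V = time_extension m g W"
  have V_prolongs: "prolongs i (\<lambda>s. V (z(i := s))) s" for i z s
    unfolding V_def by (intro time_extension_prolongs g W_prolongs)
  have V_cont: "continuous_on UNIV V"
    unfolding V_def by (intro continuous_on_coordinatewise_then_product time_extension_continuous g W_cont)
  have V_initial: "V z (U M) = W z (U M)" if "count M Vt \<le> m" "z Vt = 0" for z M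
    unfolding V_def using that g(3) by (intro time_extension_initial) auto
  have V_Ind: "V z (Ind k) = z k" for z k
    by (simp add: V_def time_extension_def)

  \<comment> \<open>On the jet of the zero function, which solves the equation, both the law and \<open>P\<close> vanish.\<close>
  have zero: "Q i p = 0" if p: "\<forall>M. p (U M) = 0" for i and p :: "'n jet"
  proof -
    have "solution_jet f a b p c = p c" for c
      using solution_jet_zero[OF f p, of a b] p by (cases c) (simp_all add: solution_jet_def)
    then have "solution_jet f a b p = p" by blast
    then have "P i p = 0"
      using P0 solution_jet_in_equation[OF f a, of b p] by simp
    moreover have "multiplier_law f a b h i p = 0"
      using p by (cases i) (simp_all add: multiplier_law_def)
    ultimately show ?thesis using PQ[of i p] by simp
  qed
  have Q_cont: "continuous_on UNIV (Q i)" for i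
    by (rule differential_functionE[OF Q[of i]])
  have "integral (cbox (\<alpha>, \<chi> j. \<alpha>) (\<beta>, \<chi> j. \<beta>)) (\<lambda>w. Q Vt (V (point 0 w))) = 0"
  proof (rule conserved_integral)
    show "((\<lambda>s. Q i (V (z(i := s)))) has_field_derivative total_deriv i (Q i) (V (z(i := s)))) (at s)" for i z s
      by (rule total_deriv_prolongs[OF Q V_prolongs])
    show "continuous_on UNIV (\<lambda>z. Q i (V z))" for i
      by (rule continuous_on_compose2[OF Q_cont V_cont]) simp
    show "continuous_on UNIV (\<lambda>z. total_deriv i (Q i) (V z))" for i
      by (rule continuous_on_compose2[OF continuous_on_total_deriv[OF Q] V_cont]) simp
    show "total_deriv Vt (Q Vt) (V z) + total_deriv Vx (Q Vx) (V z) +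
        (\<Sum>j\<in>UNIV. total_deriv (Vy j) (Q (Vy j)) (V z)) = 0" for z
      using div[of "V z"] by (simp add: total_divergence_def)
    show "Q i (V z) = 0" if "k \<noteq> Vt" "z k \<notin> {\<alpha>..\<beta>}" for i z k
      by (rule zero) (use that W_outside[of k "z(Vt := 0)"] in \<open>simp add: V_def time_extension_def\<close>)
    show "Q Vt (V z) = 0" if "z Vt = 2" for z
    proof (rule zero)
      have "(deriv ^^ k) (g j) 2 = 0" for j k
        by (rule iterated_deriv_eq_0[of "{1<..}"]) (auto simp: g(2))
      then show "\<forall>M. V z (U M) = 0"
        using that by (simp add: V_def time_extension_def)
    qed
  qed
  moreover have Q_eq: "Q Vt (V (point 0 w)) = h (fst w) * a * (B (fst w) * (\<Prod>j\<in>UNIV. B (snd w $ j)))"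
    for w :: "real \<times> (real ^ 'n)"
  proof -
    let ?z = "point 0 w :: 'n indvar \<Rightarrow> real"
    have z: "?z Vt = 0" by (simp add: point_def)
    have "P Vt (V ?z) = P Vt (W ?z)"
    proof (rule S(2), rule ballI)
      fix c assume "c \<in> S"
      then show "V ?z c = W ?z c"
        using m(2) V_initial z by (cases c) (auto simp: V_Ind W_Ind)
    qed
    also have "\<dots> = 0"
      unfolding W_def by (intro P0 solution_jet_in_equation f a)
    finally have "Q Vt (V ?z) = multiplier_law f a b h Vt (V ?z)"
      using PQ[of Vt "V ?z"] by simp
    also have "\<dots> = h (fst w) * a * (B (fst w) * (\<Prod>j\<in>UNIV. B (snd w $ j)))"
      using z m(1) by (simp add: multiplier_law_def V_initial V_Ind)
        (simp add: W_def solution_jet_param[OF f] bump_data_def point_def)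
    finally show ?thesis .
  qed
  ultimately have integral0: "integral (cbox (\<alpha>, \<chi> j. \<alpha>) (\<beta>, \<chi> j. \<beta>))
      (\<lambda>w :: real \<times> (real ^ 'n). h (fst w) * a * (B (fst w) * (\<Prod>j\<in>UNIV. B (snd w $ j)))) = 0"
    by simp
  define \<phi> where "\<phi> = (\<lambda>w :: real \<times> (real ^ 'n). \<sigma> * (h (fst w) * a * (B (fst w) * (\<Prod>j\<in>UNIV. B (snd w $ j)))))"
  have B_cont: "continuous_on UNIV B"
    using smooth_real_DERIV[OF B(1)] by (meson DERIV_isCont continuous_at_imp_continuous_on)
  have comp: "continuous_on A (\<lambda>w. F (q w))" if "continuous_on UNIV F" "continuous_on A q"
    for A and F :: "real \<Rightarrow> real" and q :: "real \<times> (real ^ 'n) \<Rightarrow> real"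
    by (rule continuous_on_compose2[OF that]) simp
  have \<phi>_cont: "continuous_on A \<phi>" for A
    unfolding \<phi>_def
    by (intro continuous_on_mult continuous_on_const continuous_on_prod comp[OF h] comp[OF B_cont]
        continuous_intros)
  have "\<phi> w = \<sigma> * (h (fst w) * a) * B (fst w) * (\<Prod>j\<in>UNIV. B (snd w $ j))" for w
    by (simp add: \<phi>_def mult_ac)
  moreover have B_nonneg: "B x \<ge> 0" for x
    using B(2,3)[of x] by (cases "x \<in> {\<alpha><..<\<beta>}") (auto intro: less_imp_le)
  moreover have "\<sigma> * (h x * a) * B x \<ge> 0" for x
    using B(3)[of x] pos[of x] B_nonneg[of x] by (cases "x \<in> {\<alpha><..<\<beta>}") auto
  ultimately have \<phi>_nonneg: "\<phi> w \<ge> 0" for w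
    by (simp add: prod_nonneg)
  have "(\<phi> has_integral 0) (cbox (\<alpha>, \<chi> j. \<alpha>) (\<beta>, \<chi> j. \<beta>))"
    using integrable_integral[OF integrable_continuous[OF \<phi>_cont, of "(\<alpha>, \<chi> j. \<alpha>)" "(\<beta>, \<chi> j. \<beta>)"]] integral0
    by (simp add: \<phi>_def)
  moreover have box: "(x0, \<chi> j. x0) \<in> box (\<alpha>, \<chi> j. \<alpha>) (\<beta>, (\<chi> j. \<beta>) :: real ^ 'n)"
    using e(1) by (auto simp: \<alpha>_def \<beta>_def mem_box Basis_prod_def Basis_vec_def inner_axis)
  ultimately have "\<phi> (x0, \<chi> j. x0) = 0"
    using has_integral_0_cbox_imp_0[OF \<phi>_cont \<phi>_nonneg] box_subset_cbox by blast
  moreover have "\<phi> (x0, \<chi> j. x0) > 0"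
    using pos[of x0] B(2)[of x0] e(1) by (simp add: \<phi>_def \<alpha>_def \<beta>_def mult.assoc[symmetric] prod_pos)
  ultimately show False by simp
qed

lemma multiplier_law_conservation_law:
  assumes f: "smooth_real f"
  shows "conservation_law (pde_lhs f a b) (multiplier_law f a b (\<lambda>x. x ^ k) :: ('n::finite) jet_tuple)"
proof -
  note alg = jet_alg.intros jet_alg_power jet_alg_total_deriv[OF f] jet_alg_fu[OF f]
  define X :: "'n jet_fun" where "X = (\<lambda>p. p (Ind Vx) ^ k)"
  define Y :: "'n jet_fun" where
    "Y = (\<lambda>p. p (U {#Vx#}) + total_deriv Vt (\<lambda>p. f (p (U {#}))) p + a * p (U {#Vt, Vt#}))"
  have X: "jet_alg f X" and Y: "jet_alg f Y"
    unfolding X_def Y_def by (intro alg)+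
  have law_t: "multiplier_law f a b (\<lambda>x. x ^ k) Vt = (\<lambda>p. X p * Y p)"
    and law_x: "multiplier_law f a b (\<lambda>x. x ^ k) Vx = (\<lambda>p. 0 :: real)"
    and law_y: "multiplier_law f a b (\<lambda>x. x ^ k) (Vy j) = (\<lambda>p. b * X p * p (U {#Vy j#}))" for j :: 'n
    by (rule ext, simp add: multiplier_law_def X_def Y_def total_deriv_fu[OF f])+
  have D_X: "total_deriv i X = (\<lambda>p. 0)" if "i \<noteq> Vx" for i
  proof
    fix p show "total_deriv i X p = 0"
      by (rule total_deriv_eqI[OF jet_alg_smooth[OF f X]]) (use that in \<open>simp add: X_def flow_def\<close>)
  qed
  have D_Y: "total_deriv Vt Y = (\<lambda>p. p (U {#Vt, Vx#}) +
      total_deriv Vt (total_deriv Vt (\<lambda>p. f (p (U {#})))) p + a * p (U {#Vt, Vt, Vt#}))"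
    unfolding Y_def by (simp add: total_deriv_add[OF f] total_deriv_cmult[OF f] total_deriv_coord[OF f] alg)
  have D_y: "total_deriv (Vy j) (\<lambda>p. b * X p * p (U {#Vy j#})) = (\<lambda>p. b * X p * p (U {#Vy j, Vy j#}))" for j
    by (simp add: total_deriv_mult[OF f] total_deriv_const[OF f] D_X total_deriv_coord[OF f] alg X mult_ac)
  have "total_divergence (multiplier_law f a b (\<lambda>x. x ^ k)) p = X p * pde_lhs f a b p" for p :: "'n jet"
    unfolding total_divergence_def law_t law_x law_y D_y total_deriv_mult[OF f X Y] total_deriv_const[OF f]
    by (simp add: D_X D_Y pde_lhs_def algebra_simps sum_distrib_left)
  moreover have "pde_lhs f a b p = 0" if "p \<in> equation_jets (pde_lhs f a b)" for p :: "'n jet"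
  proof -
    have "fold total_deriv [] (pde_lhs f a b) p = 0"
      using that unfolding equation_jets_def by blast
    then show ?thesis by simp
  qed
  moreover have "jet_alg f (multiplier_law f a b (\<lambda>x. x ^ k) i)" for i :: "'n indvar"
    by (cases i) (simp_all only: law_t law_x law_y, (intro alg X Y)+)
  ultimately show ?thesis
    unfolding conservation_law_def vanishes_modulo_def by (simp add: jet_alg_smooth[OF f])
qed

theorem mainTheorem2:
  fixes f :: "real \<Rightarrow> real" and a b :: real
  assumes "a \<noteq> 0" and "b \<noteq> 0"
    and "smooth_real f"
    and "\<exists>s. deriv (deriv f) s \<noteq> 0"
  shows "\<exists>S :: ('n::finite) jet_tuple set.
           infinite S \<and>
           (\<forall>C\<in>S. nontrivial_conservation_law (pde_lhs f a b) C) \<and>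
           (\<forall>C\<in>S. \<forall>C'\<in>S. C \<noteq> C' \<longrightarrow> \<not> equivalent_tuples (pde_lhs f a b) C C')"
proof -
  define C :: "nat \<Rightarrow> 'n jet_tuple" where "C = (\<lambda>k. multiplier_law f a b (\<lambda>x. x ^ k))"
  define p :: "'n jet" where "p = (\<lambda>c. if c = Ind Vx then 2 else if c = U {#Vx#} then 1 else 0)"
  have C_p: "C k Vt p = 2 ^ k" for k
    by (simp add: C_def multiplier_law_def p_def)
  have "inj C"
  proof (intro injI)
    fix k m assume "C k = C m"
    then have "C k Vt p = C m Vt p"
      by (rule arg_cong)
    then have "(2 :: real) ^ k = 2 ^ m"
      unfolding C_p .
    then show "k = m" by simp
  qed
  then have "infinite (range C)"
    by (rule range_inj_infinite)
  moreover have "nontrivial_conservation_law (pde_lhs f a b) (C k)" for k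
    unfolding nontrivial_conservation_law_def
  proof
    show "conservation_law (pde_lhs f a b) (C k)"
      unfolding C_def by (rule multiplier_law_conservation_law[OF assms(3)])
    have "continuous_on UNIV (\<lambda>x :: real. x ^ k)"
      by (intro continuous_intros)
    then have "(1 :: real) ^ k = 0" if "trivial_tuple (pde_lhs f a b) (C k)"
      using trivial_multiplier_law_imp_zero[OF assms(3,1), of "\<lambda>x. x ^ k" b 1] that unfolding C_def by blast
    then show "\<not> trivial_tuple (pde_lhs f a b) (C k)"
      by auto
  qed
  moreover have "\<not> equivalent_tuples (pde_lhs f a b) (C k) (C m)" if "C k \<noteq> C m" for k m
  proof
    assume eq: "equivalent_tuples (pde_lhs f a b) (C k) (C m)"
    have "(\<lambda>i p. C k i p - C m i p) = multiplier_law f a b (\<lambda>x. x ^ k - x ^ m)"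
    proof (intro ext)
      fix i p show "C k i p - C m i p = multiplier_law f a b (\<lambda>x. x ^ k - x ^ m) i p"
        by (cases i) (simp_all add: C_def multiplier_law_def algebra_simps)
    qed
    then have "trivial_tuple (pde_lhs f a b) (multiplier_law f a b (\<lambda>x. x ^ k - x ^ m) :: 'n jet_tuple)"
      using eq unfolding equivalent_tuples_def by (simp only:)
    moreover have "continuous_on UNIV (\<lambda>x :: real. x ^ k - x ^ m)"
      by (intro continuous_intros)
    ultimately have "2 ^ k - 2 ^ m = (0 :: real)"
      using trivial_multiplier_law_imp_zero[OF assms(3,1), of "\<lambda>x. x ^ k - x ^ m" b 2] by blast
    then have "k = m" by simp
    then show False using that by simp
  qed
  ultimately show ?thesis
    by (intro exI[of _ "range C"]) auto
qed

end
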